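(* The algebra $\mathfrak{pvb}_n^!$ has a basis consisting exactly of the monomials corresponding to chain gangs on $[n]=\{1,\dots,n\}$; that is, for each unordered partition of $[n]$ into nonempty linearly ordered subsets (chains) $(a_1,\dots,a_s)$, the element $\bigwedge_{\text{chains}} (r_{a_1a_2}\wedge r_{a_2a_3}\wedge\cdots\wedge r_{a_{s-1}a_s})$ (a chain of length one contributing the empty product), and these elements (each determined up to sign) form a basis.
   Context: $\mathfrak{pvb}_n^!$ is the graded $\mathbb{Q}$-algebra obtained as the quotient of the exterior algebra on degree-1 generators $r_{ij}$, $1\le i\ne j\le n$, by the ideal generated by $r_{ij}\wedge r_{ik}=r_{ij}\wedge r_{jk}-r_{ik}\wedge r_{kj}$, $r_{ik}\wedge r_{jk}=r_{ij}\wedge r_{jk}-r_{ji}\wedge r_{ik}$ (for $i,j,k$ distinct) and $r_{ij}\wedge r_{ji}=0$. A monomial $r_{i_1j_1}\wedge\cdots\wedge r_{i_mj_m}$ corresponds to the directed graph on vertex set $[n]$ with edges $(i_1,j_1),\dots,(i_m,j_m)$; a chain gang is the graph formed by directed paths $a_1\to a_2\to\cdots\to a_s$ over the blocks of an unordered partition of $[n]$ into ordered subsets. *)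

theory Defs
  imports Complex_Main "HOL-Library.Product_Lexorder" "HOL-Library.List_Lexorder"
begin

text \<open>Exterior algebra over the rationals on generators r_ij, (i,j) in Gen n.
  An element is a coefficient function on the standard basis monomials
  e_S (S a finite set of generators, wedged in increasing lexicographic order).\<close>

type_synonym ext = "(nat \<times> nat) set \<Rightarrow> rat"

definition Gen :: "nat \<Rightarrow> (nat \<times> nat) set" where
  "Gen n = {(i,j). i \<in> {1..n} \<and> j \<in> {1..n} \<and> i \<noteq> j}"

definition Ext :: "nat \<Rightarrow> ext set" where
  "Ext n = {a. \<forall>S. a S \<noteq> 0 \<longrightarrow> S \<subseteq> Gen n}"

definition wsign :: "(nat \<times> nat) set \<Rightarrow> (nat \<times> nat) set \<Rightarrow> rat" where
  "wsign S T = (if S \<inter> T = {} then (-1) ^ card {(s,t). s \<in> S \<and> t \<in> T \<and> t < s} else 0)"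

definition wedge :: "ext \<Rightarrow> ext \<Rightarrow> ext" where
  "wedge a b = (\<lambda>U. \<Sum>S\<in>Pow U. a S * b (U - S) * wsign S (U - S))"

definition one :: ext where
  "one = (\<lambda>S. if S = {} then 1 else 0)"

definition gen :: "nat \<Rightarrow> nat \<Rightarrow> ext" where
  "gen i j = (\<lambda>S. if S = {(i,j)} then 1 else 0)"

definition eadd :: "ext \<Rightarrow> ext \<Rightarrow> ext" where
  "eadd a b = (\<lambda>S. a S + b S)"

definition esub :: "ext \<Rightarrow> ext \<Rightarrow> ext" where
  "esub a b = (\<lambda>S. a S - b S)"

definition Rel :: "nat \<Rightarrow> ext set" where
  "Rel n =
    {esub (wedge (gen i j) (gen i k))
          (esub (wedge (gen i j) (gen j k)) (wedge (gen i k) (gen k j))) | i j k.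
       i \<in> {1..n} \<and> j \<in> {1..n} \<and> k \<in> {1..n} \<and> i \<noteq> j \<and> i \<noteq> k \<and> j \<noteq> k}
   \<union> {esub (wedge (gen i k) (gen j k))
          (esub (wedge (gen i j) (gen j k)) (wedge (gen j i) (gen i k))) | i j k.
       i \<in> {1..n} \<and> j \<in> {1..n} \<and> k \<in> {1..n} \<and> i \<noteq> j \<and> i \<noteq> k \<and> j \<noteq> k}
   \<union> {wedge (gen i j) (gen j i) | i j. i \<in> {1..n} \<and> j \<in> {1..n} \<and> i \<noteq> j}"

inductive_set Ideal :: "nat \<Rightarrow> ext set" for n where
  zero: "(\<lambda>S. 0) \<in> Ideal n"
| gen: "r \<in> Rel n \<Longrightarrow> x \<in> Ext n \<Longrightarrow> y \<in> Ext n \<Longrightarrow> wedge (wedge x r) y \<in> Ideal n"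
| add: "a \<in> Ideal n \<Longrightarrow> b \<in> Ideal n \<Longrightarrow> eadd a b \<in> Ideal n"

definition mono :: "(nat \<times> nat) list \<Rightarrow> ext" where
  "mono es = foldr (\<lambda>(i,j) acc. wedge (gen i j) acc) es one"

definition path_edges :: "nat list \<Rightarrow> (nat \<times> nat) list" where
  "path_edges as = zip as (tl as)"

definition chain_gangs :: "nat \<Rightarrow> nat list set set" where
  "chain_gangs n = {P. finite P \<and> (\<forall>b\<in>P. b \<noteq> [] \<and> distinct b)
      \<and> (\<forall>b\<in>P. \<forall>c\<in>P. b \<noteq> c \<longrightarrow> set b \<inter> set c = {})
      \<and> (\<Union>b\<in>P. set b) = {1..n}}"

text \<open>the chain-gang monomial (blocks wedged in a fixed order; sign irrelevant)\<close>
definition cg_mono :: "nat list set \<Rightarrow> ext" where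
  "cg_mono P = foldr wedge (map (\<lambda>b. mono (path_edges b)) (sorted_list_of_set P)) one"

end

theory Submission
  imports Defs
begin

text \<open>
  Spanning: modulo the ideal, two edges leaving a vertex, or two edges entering it, can be combed
  into directed paths, and a monomial containing a directed cycle vanishes. Hence the span of the
  chain gangs is stable under multiplication by a generator.

  Independence: for a chain gang \<open>P\<close>, order each block along its chain, attach an odd variable
  \<open>z v\<close> to each vertex, and send \<open>r i j\<close> to the sum of \<open>z v\<close> over the half-open interval \<open>(i, j]\<close>
  of this order, or to \<open>0\<close> unless \<open>i\<close> precedes \<open>j\<close>. Additivity of intervals and \<open>y \<and> y = 0\<close> for
  linear forms \<open>y\<close> make the relations vanish. The monomial of a chain gang \<open>Q\<close> survives only if the
  order of \<open>Q\<close> is contained in that of \<open>P\<close>, and the monomial of \<open>P\<close> goes to a product of distinct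
  variables, so the coefficients vanish by induction on the size of the order.
\<close>

section \<open>The exterior algebra\<close>

definition scl :: "rat \<Rightarrow> ext \<Rightarrow> ext" where
  "scl c a = (\<lambda>S. c * a S)"

definition bas :: "(nat \<times> nat) set \<Rightarrow> ext" where
  "bas S = (\<lambda>T. if T = S then 1 else 0)"

lemma gen_eq_bas: "gen i j = bas {(i, j)}"
  by (simp add: gen_def bas_def)

lemma one_eq_bas: "one = bas {}"
  by (simp add: one_def bas_def)

lemma scl_one [simp]: "scl 1 a = a"
  by (simp add: scl_def)

lemma scl_scl [simp]: "scl c (scl d a) = scl (c * d) a"
  by (simp add: scl_def mult.assoc)

lemma scl_zero [simp]: "scl 0 a = (\<lambda>S. 0)"
  by (simp add: scl_def)

lemma wedge_eadd_left: "wedge (eadd a b) c = eadd (wedge a c) (wedge b c)"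
  by (simp add: wedge_def eadd_def algebra_simps sum.distrib)

lemma wedge_eadd_right: "wedge a (eadd b c) = eadd (wedge a b) (wedge a c)"
  by (simp add: wedge_def eadd_def algebra_simps sum.distrib)

lemma wedge_esub_left: "wedge (esub a b) c = esub (wedge a c) (wedge b c)"
  by (simp add: wedge_def esub_def algebra_simps sum_subtractf)

lemma wedge_esub_right: "wedge a (esub b c) = esub (wedge a b) (wedge a c)"
  by (simp add: wedge_def esub_def algebra_simps sum_subtractf)

lemma wedge_scl_left: "wedge (scl c a) b = scl c (wedge a b)"
  by (simp add: wedge_def scl_def sum_distrib_left mult.assoc)

lemma wedge_scl_right: "wedge a (scl c b) = scl c (wedge a b)"
  by (simp add: wedge_def scl_def sum_distrib_left mult_ac)

lemma wedge_zero_left [simp]: "wedge (\<lambda>S. 0) b = (\<lambda>S. 0)"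
  by (simp add: wedge_def)

lemma wedge_zero_right [simp]: "wedge a (\<lambda>S. 0) = (\<lambda>S. 0)"
  by (simp add: wedge_def)

lemma wedge_sum_left:
  "wedge (\<lambda>S. \<Sum>i\<in>I. c i * f i S) b = (\<lambda>S. \<Sum>i\<in>I. c i * wedge (f i) b S)"
proof
  fix U
  show "wedge (\<lambda>S. \<Sum>i\<in>I. c i * f i S) b U = (\<Sum>i\<in>I. c i * wedge (f i) b U)"
    unfolding wedge_def sum_distrib_left sum_distrib_right
    by (subst sum.swap) (simp add: mult.assoc)
qed

lemma wedge_sum_right:
  "wedge a (\<lambda>S. \<Sum>i\<in>I. c i * f i S) = (\<lambda>S. \<Sum>i\<in>I. c i * wedge a (f i) S)"
proof
  fix U
  show "wedge a (\<lambda>S. \<Sum>i\<in>I. c i * f i S) U = (\<Sum>i\<in>I. c i * wedge a (f i) U)"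
    unfolding wedge_def sum_distrib_left sum_distrib_right
    by (subst sum.swap) (simp add: mult_ac)
qed

lemma wedge_infinite: "infinite U \<Longrightarrow> wedge a b U = 0"
  by (simp add: wedge_def)

lemma wedge_bas:
  assumes "finite S" "finite T"
  shows "wedge (bas S) (bas T) = scl (wsign S T) (bas (S \<union> T))"
proof
  fix U
  have "wedge (bas S) (bas T) U = (\<Sum>X\<in>Pow U. if X = S then bas T (U - S) * wsign S (U - S) else 0)"
    unfolding wedge_def by (rule sum.cong) (auto simp: bas_def)
  also have "\<dots> = (if finite U \<and> S \<subseteq> U then bas T (U - S) * wsign S (U - S) else 0)"
    by (cases "finite U") auto
  also have "\<dots> = scl (wsign S T) (bas (S \<union> T)) U"
  proof (cases "S \<inter> T = {} \<and> U = S \<union> T")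
    case True
    then have "U - S = T" by auto
    then show ?thesis using True assms by (simp add: scl_def bas_def)
  next
    case False
    then have "\<not> (S \<subseteq> U \<and> U - S = T)" by auto
    then show ?thesis using False by (auto simp: scl_def bas_def wsign_def)
  qed
  finally show "wedge (bas S) (bas T) U = scl (wsign S T) (bas (S \<union> T)) U" .
qed

text \<open>On an infinite \<open>U\<close> the sum defining \<open>wedge\<close> takes the default
  value 0, so a unit law can hold only for elements supported on finite sets.\<close>

lemma wedge_one_left:
  assumes "\<And>S. a S \<noteq> 0 \<Longrightarrow> finite S"
  shows "wedge one a = a"
proof
  fix U
  have "wedge one a U = (\<Sum>X\<in>Pow U. if X = {} then a U * wsign {} U else 0)"
    unfolding wedge_def by (rule sum.cong) (auto simp: one_def)
  also have "\<dots> = (if finite U then a U else 0)"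
    by (cases "finite U") (auto simp: wsign_def)
  finally show "wedge one a U = a U" using assms by auto
qed

lemma wedge_one_right:
  assumes "\<And>S. a S \<noteq> 0 \<Longrightarrow> finite S"
  shows "wedge a one = a"
proof
  fix U
  have "wedge a one U = (\<Sum>X\<in>Pow U. if X = U then a U * wsign U {} else 0)"
    unfolding wedge_def by (rule sum.cong) (auto simp: one_def)
  also have "\<dots> = (if finite U then a U else 0)"
    by (cases "finite U") (auto simp: wsign_def)
  finally show "wedge a one U = a U" using assms by auto
qed

text \<open>The inversions against \<open>U\<close> are counted additively over the disjoint parts
  \<open>S\<close> and \<open>T\<close>; if \<open>U\<close> meets either part, both sides are
  0.\<close>

lemma wsign_Un_left:
  assumes "finite S" "finite T" "finite U" "S \<inter> T = {}"
  shows "wsign (S \<union> T) U = wsign S U * wsign T U"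
proof -
  have "{(s,t). s \<in> S \<union> T \<and> t \<in> U \<and> t < s}
      = {(s,t). s \<in> S \<and> t \<in> U \<and> t < s} \<union> {(s,t). s \<in> T \<and> t \<in> U \<and> t < s}"
    by auto
  moreover have "finite {(s,t). s \<in> S \<and> t \<in> U \<and> t < s}" "finite {(s,t). s \<in> T \<and> t \<in> U \<and> t < s}"
    using assms by (auto intro: finite_subset[of _ "S \<times> U"] finite_subset[of _ "T \<times> U"])
  moreover have "{(s,t). s \<in> S \<and> t \<in> U \<and> t < s} \<inter> {(s,t). s \<in> T \<and> t \<in> U \<and> t < s} = {}"
    using assms by auto
  ultimately have "card {(s,t). s \<in> S \<union> T \<and> t \<in> U \<and> t < s}
      = card {(s,t). s \<in> S \<and> t \<in> U \<and> t < s} + card {(s,t). s \<in> T \<and> t \<in> U \<and> t < s}"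
    by (simp add: card_Un_disjoint)
  then show ?thesis
    by (auto simp: wsign_def power_add Int_Un_distrib2)
qed

lemma wsign_Un_right:
  assumes "finite S" "finite T" "finite U" "T \<inter> U = {}"
  shows "wsign S (T \<union> U) = wsign S T * wsign S U"
proof -
  have "{(s,t). s \<in> S \<and> t \<in> T \<union> U \<and> t < s}
      = {(s,t). s \<in> S \<and> t \<in> T \<and> t < s} \<union> {(s,t). s \<in> S \<and> t \<in> U \<and> t < s}"
    by auto
  moreover have "finite {(s,t). s \<in> S \<and> t \<in> T \<and> t < s}" "finite {(s,t). s \<in> S \<and> t \<in> U \<and> t < s}"
    using assms by (auto intro: finite_subset[of _ "S \<times> U"] finite_subset[of _ "S \<times> T"])
  moreover have "{(s,t). s \<in> S \<and> t \<in> T \<and> t < s} \<inter> {(s,t). s \<in> S \<and> t \<in> U \<and> t < s} = {}"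
    using assms by auto
  ultimately have "card {(s,t). s \<in> S \<and> t \<in> T \<union> U \<and> t < s}
      = card {(s,t). s \<in> S \<and> t \<in> T \<and> t < s} + card {(s,t). s \<in> S \<and> t \<in> U \<and> t < s}"
    by (simp add: card_Un_disjoint)
  then show ?thesis
    by (auto simp: wsign_def power_add Int_Un_distrib)
qed

lemma wsign_nonzero: "S \<inter> T = {} \<Longrightarrow> wsign S T \<noteq> 0"
  by (simp add: wsign_def)

lemma wsign_singleton: "wsign {s} {t} = (if s = t then 0 else if t < s then -1 else 1)"
proof -
  have "{(a,b). a \<in> {s} \<and> b \<in> {t} \<and> b < a} = (if t < s then {(s,t)} else {})"
    by auto
  then show ?thesis
    by (simp only: wsign_def) simp
qed

text \<open>Both sides sum over the splittings of \<open>U\<close> into three disjoint parts, and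
  either sign is the product of the three pairwise signs.\<close>

lemma wedge_assoc: "wedge (wedge a b) c = wedge a (wedge b c)"
proof
  fix U
  show "wedge (wedge a b) c U = wedge a (wedge b c) U"
  proof (cases "finite U")
    case False
    then show ?thesis by (simp add: wedge_infinite)
  next
    case True
    have fin: "\<And>S. S \<subseteq> U \<Longrightarrow> finite S"
      using True by (rule finite_subset[rotated])
    have "wedge (wedge a b) c U = (\<Sum>(S,T)\<in>Sigma (Pow U) Pow.
        a T * b (S - T) * wsign T (S - T) * c (U - S) * wsign S (U - S))"
      unfolding wedge_def using fin
      by (subst sum.Sigma[symmetric]) (auto simp: True sum_distrib_right)
    also have "\<dots> = (\<Sum>(T,R)\<in>Sigma (Pow U) (\<lambda>T. Pow (U - T)).
        a T * (b R * c (U - T - R) * wsign R (U - T - R)) * wsign T (U - T))"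
    proof (rule sum.reindex_bij_witness[where i="\<lambda>(T,R). (T \<union> R, T)" and j="\<lambda>(S,T). (T, S - T)"],
        goal_cases)
      \<comment> \<open>The fifth goal is the equality of the summands; the other four, left to
        \<open>auto\<close>, say that the two maps are mutually inverse between the index
        sets.\<close>
      case (5 x)
      then obtain S T where x: "x = (S,T)" and sub: "S \<subseteq> U" "T \<subseteq> S" by auto
      have S: "S = T \<union> (S - T)" and UT: "U - T = (S - T) \<union> (U - S)" and U: "U - T - (S - T) = U - S"
        using sub by auto
      have fins: "finite T" "finite (S - T)" "finite (U - S)" using fin sub by auto
      have "wsign S (U - S) = wsign T (U - S) * wsign (S - T) (U - S)"
        using wsign_Un_left[OF fins] S by auto
      moreover have "wsign T (U - T) = wsign T (S - T) * wsign T (U - S)"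
        unfolding UT using wsign_Un_right[OF fins] by auto
      ultimately show ?case by (simp add: x U mult_ac)
    qed auto
    also have "\<dots> = wedge a (wedge b c) U"
      unfolding wedge_def using fin
      by (subst sum.Sigma[symmetric]) (auto simp: True sum_distrib_right sum_distrib_left)
    finally show ?thesis .
  qed
qed

lemma finite_Gen: "finite (Gen n)"
  by (rule finite_subset[of _ "{1..n} \<times> {1..n}"]) (auto simp: Gen_def)

lemma bas_Ext: "S \<subseteq> Gen n \<Longrightarrow> bas S \<in> Ext n"
  by (auto simp: Ext_def bas_def)

lemma one_Ext: "one \<in> Ext n"
  by (simp add: one_eq_bas bas_Ext)

lemma wedge_Ext:
  assumes "a \<in> Ext n" "b \<in> Ext n"
  shows "wedge a b \<in> Ext n"
  unfolding Ext_def
proof (safe)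
  fix U i j assume "wedge a b U \<noteq> 0" and ij: "(i, j) \<in> U"
  then obtain S where "S \<subseteq> U" "a S \<noteq> 0" "b (U - S) \<noteq> 0"
    unfolding wedge_def by (metis (no_types, lifting) PowD mult_not_zero sum.neutral)
  then show "(i, j) \<in> Gen n"
    using assms ij unfolding Ext_def by blast
qed

lemma esub_Ext: "a \<in> Ext n \<Longrightarrow> b \<in> Ext n \<Longrightarrow> esub a b \<in> Ext n"
  unfolding Ext_def esub_def mem_Collect_eq by (metis diff_zero)

lemma scl_Ext: "a \<in> Ext n \<Longrightarrow> scl c a \<in> Ext n"
  by (auto simp: Ext_def scl_def)

lemma Ext_finite: "a \<in> Ext n \<Longrightarrow> a S \<noteq> 0 \<Longrightarrow> finite S"
  using finite_Gen finite_subset by (fastforce simp: Ext_def)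

lemma gen_Ext: "i \<in> {1..n} \<Longrightarrow> j \<in> {1..n} \<Longrightarrow> i \<noteq> j \<Longrightarrow> gen i j \<in> Ext n"
  by (simp add: gen_eq_bas bas_Ext Gen_def)

lemma Rel_Ext: "r \<in> Rel n \<Longrightarrow> r \<in> Ext n"
  unfolding Rel_def by (auto intro!: esub_Ext wedge_Ext gen_Ext)

lemma Ext_decomp:
  assumes "a \<in> Ext n"
  shows "a = (\<lambda>T. \<Sum>S\<in>Pow (Gen n). a S * bas S T)"
proof
  fix T
  have "(\<Sum>S\<in>Pow (Gen n). a S * bas S T) = (\<Sum>S\<in>Pow (Gen n). if S = T then a T else 0)"
    by (rule sum.cong) (auto simp: bas_def)
  also have "\<dots> = (if T \<subseteq> Gen n then a T else 0)"
    using finite_Gen by simp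
  finally show "a T = (\<Sum>S\<in>Pow (Gen n). a S * bas S T)"
    using assms by (auto simp: Ext_def)
qed

text \<open>Disjoint supports keep every sign nonzero. The index type is abstract because the lemma
  serves the edges of a path, the blocks of a gang and the images of edges under interval
  forms.\<close>

lemma foldr_wedge_bas:
  assumes "distinct xs"
    and "\<And>x. x \<in> set xs \<Longrightarrow> finite (h x) \<and> (\<exists>s. s \<noteq> 0 \<and> g x = scl s (bas (h x)))"
    and "\<And>x y. x \<in> set xs \<Longrightarrow> y \<in> set xs \<Longrightarrow> x \<noteq> y \<Longrightarrow> h x \<inter> h y = {}"
  shows "\<exists>s. s \<noteq> 0 \<and> foldr (\<lambda>x. wedge (g x)) xs one = scl s (bas (\<Union>x\<in>set xs. h x))"
  using assms
proof (induction xs)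
  case Nil
  then show ?case by (auto simp: one_eq_bas intro!: exI[of _ 1])
next
  case (Cons x xs)
  then obtain s where s: "s \<noteq> 0" "foldr (\<lambda>x. wedge (g x)) xs one = scl s (bas (\<Union>x\<in>set xs. h x))"
    by auto
  obtain t where t: "t \<noteq> 0" "g x = scl t (bas (h x))" using Cons.prems(2)[of x] by auto
  have "h x \<inter> (\<Union>x\<in>set xs. h x) = {}" using Cons.prems by fastforce
  then have "wsign (h x) (\<Union>x\<in>set xs. h x) \<noteq> 0" by (rule wsign_nonzero)
  moreover have "finite (h x)" "finite (\<Union>x\<in>set xs. h x)" using Cons.prems by auto
  ultimately show ?case using s t
    by (intro exI[of _ "t * s * wsign (h x) (\<Union>x\<in>set xs. h x)"])
       (simp add: wedge_scl_left wedge_scl_right wedge_bas mult_ac)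
qed

section \<open>Chain gangs and their monomials\<close>

abbreviation pset :: "nat list \<Rightarrow> (nat \<times> nat) set" where
  "pset l \<equiv> set (path_edges l)"

definition gang_edges :: "nat list set \<Rightarrow> (nat \<times> nat) set" where
  "gang_edges P = (\<Union>b\<in>P. pset b)"

lemma path_edges_simps [simp]:
  "path_edges [] = []" "path_edges [a] = []"
  "path_edges (a # b # l) = (a, b) # path_edges (b # l)"
  by (simp_all add: path_edges_def)

lemma path_edges_append: "path_edges (xs @ a # ys) = path_edges (xs @ [a]) @ path_edges (a # ys)"
proof (induction xs)
  case (Cons x xs)
  then show ?case by (cases xs) auto
qed simp

lemma pset_append: "pset (xs @ a # ys) = pset (xs @ [a]) \<union> pset (a # ys)"
  by (subst path_edges_append) simp

lemma pset_snoc: "pset (xs @ [a, b]) = insert (a, b) (pset (xs @ [a]))"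
  by (subst path_edges_append) auto

text \<open>The sharp form with \<open>butlast\<close> and \<open>tl\<close> records that no edge
  leaves the last vertex of a distinct path or enters its first one; the freshness arguments below
  depend on this.\<close>

lemma pset_vertices: "(u, v) \<in> pset l \<Longrightarrow> u \<in> set (butlast l) \<and> v \<in> set (tl l)"
proof (induction l rule: induct_list012)
  case (3 x y zs)
  then show ?case by (cases zs) auto
qed auto

lemma pset_in_set: "(u, v) \<in> pset l \<Longrightarrow> u \<in> set l \<and> v \<in> set l"
  using pset_vertices[of u v l] by (auto dest: in_set_butlastD list.set_sel(2)[rotated])

lemma pset_irrefl: "distinct l \<Longrightarrow> (u, u) \<notin> pset l"
  by (induction l rule: induct_list012) auto

lemma pset_Gen: "distinct l \<Longrightarrow> set l \<subseteq> {1..n} \<Longrightarrow> pset l \<subseteq> Gen n"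
  using pset_in_set pset_irrefl by (fastforce simp: Gen_def)

lemma distinct_path_edges: "distinct l \<Longrightarrow> distinct (path_edges l)"
  by (simp add: path_edges_def distinct_zipI1)

lemma pset_conv_nth: "pset l = {(l ! p, l ! Suc p) | p. Suc p < length l}"
  by (auto simp: path_edges_def set_zip nth_tl less_diff_conv)

lemma finite_chain_gangs: "finite (chain_gangs n)"
proof (rule finite_subset)
  show "chain_gangs n \<subseteq> Pow {b. set b \<subseteq> {1..n} \<and> distinct b}"
    by (auto simp: chain_gangs_def)
  show "finite (Pow {b. set b \<subseteq> {1..n} \<and> distinct b})"
    by (simp add: finite_subset_distinct)
qed

lemma chain_gangD:
  assumes "P \<in> chain_gangs n"
  shows "finite P" "b \<in> P \<Longrightarrow> b \<noteq> []" "b \<in> P \<Longrightarrow> distinct b" "b \<in> P \<Longrightarrow> set b \<subseteq> {1..n}"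
    "b \<in> P \<Longrightarrow> c \<in> P \<Longrightarrow> v \<in> set b \<Longrightarrow> v \<in> set c \<Longrightarrow> b = c"
    "v \<in> {1..n} \<Longrightarrow> \<exists>b\<in>P. v \<in> set b"
  using assms unfolding chain_gangs_def by blast+

lemma gang_edges_Gen: "P \<in> chain_gangs n \<Longrightarrow> gang_edges P \<subseteq> Gen n"
  unfolding gang_edges_def by (intro UN_least pset_Gen; rule chain_gangD(3,4))

lemma gang_edges_Diff_vertices:
  assumes P: "P \<in> chain_gangs n" and "(u,v) \<in> gang_edges (P - B)" "b \<in> P" "b \<in> B"
  shows "u \<notin> set b" "v \<notin> set b"
proof -
  obtain c where c: "c \<in> P" "c \<noteq> b" "(u,v) \<in> pset c"
    using assms by (auto simp: gang_edges_def)
  then have "u \<in> set c" "v \<in> set c" using pset_in_set by auto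
  then show "u \<notin> set b" "v \<notin> set b"
    using chain_gangD(5)[OF P c(1) assms(3)] c(2) by auto
qed

lemma mono_eq_bas:
  assumes "distinct es"
  shows "\<exists>s. s \<noteq> 0 \<and> mono es = scl s (bas (set es))"
proof -
  have "mono es = foldr (\<lambda>e. wedge (bas {e})) es one"
    unfolding mono_def by (rule foldr_cong) (auto simp: gen_eq_bas)
  moreover have "\<exists>s. s \<noteq> 0 \<and> foldr (\<lambda>e. wedge (bas {e})) es one = scl s (bas (\<Union>e\<in>set es. {e}))"
    using assms by (intro foldr_wedge_bas) (auto intro!: exI[of _ 1])
  ultimately show ?thesis by simp
qed

text \<open>The order of the blocks affects only the scalar, so from here on a chain gang can be
  handled through its edge set alone.\<close>

lemma cg_mono_eq_bas:
  assumes P: "P \<in> chain_gangs n"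
  shows "\<exists>s. s \<noteq> 0 \<and> cg_mono P = scl s (bas (gang_edges P))"
proof -
  have "cg_mono P = foldr (\<lambda>b. wedge (mono (path_edges b))) (sorted_list_of_set P) one"
    by (simp add: cg_mono_def foldr_map comp_def)
  moreover have "\<exists>s. s \<noteq> 0 \<and> foldr (\<lambda>b. wedge (mono (path_edges b))) (sorted_list_of_set P) one
      = scl s (bas (\<Union>b\<in>set (sorted_list_of_set P). pset b))"
  proof (intro foldr_wedge_bas conjI)
    fix b c assume bc: "b \<in> set (sorted_list_of_set P)" "c \<in> set (sorted_list_of_set P)" "b \<noteq> c"
    then have "b \<in> P" "c \<in> P" using chain_gangD(1)[OF P] by auto
    then have "set b \<inter> set c = {}" using chain_gangD(5)[OF P] bc(3) by auto
    then show "pset b \<inter> pset c = {}" using pset_in_set[of _ _ b] pset_in_set[of _ _ c] by fastforce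
  next
    fix b assume "b \<in> set (sorted_list_of_set P)"
    then have "distinct b" using chain_gangD(1,3)[OF P] by auto
    then show "\<exists>s. s \<noteq> 0 \<and> mono (path_edges b) = scl s (bas (pset b))"
      by (intro mono_eq_bas distinct_path_edges)
  qed auto
  ultimately show ?thesis using chain_gangD(1)[OF P] by (simp add: gang_edges_def)
qed

section \<open>Chain gangs span\<close>

text \<open>The preimage of the span of the chain gangs in the quotient algebra; working with it
  avoids forming the quotient.\<close>

definition cgspan :: "nat \<Rightarrow> ext set" where
  "cgspan n = {a. \<exists>c. esub a (\<lambda>S. \<Sum>P\<in>chain_gangs n. c P * cg_mono P S) \<in> Ideal n}"

lemma Ideal_scl: "a \<in> Ideal n \<Longrightarrow> scl c a \<in> Ideal n"
proof (induction rule: Ideal.induct)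
  case zero
  then show ?case by (simp add: scl_def Ideal.zero)
next
  case (gen r x y)
  then have "wedge (wedge (scl c x) r) y \<in> Ideal n"
    by (intro Ideal.gen scl_Ext)
  then show ?case by (simp add: wedge_scl_left)
next
  case (add a b)
  then have "eadd (scl c a) (scl c b) \<in> Ideal n" by (intro Ideal.add)
  then show ?case by (simp add: eadd_def scl_def algebra_simps)
qed

lemma Ideal_wedge_left: "a \<in> Ideal n \<Longrightarrow> z \<in> Ext n \<Longrightarrow> wedge z a \<in> Ideal n"
proof (induction rule: Ideal.induct)
  case zero
  then show ?case by (simp add: Ideal.zero)
next
  case (gen r x y)
  then have "wedge (wedge (wedge z x) r) y \<in> Ideal n"
    by (intro Ideal.gen wedge_Ext)
  then show ?case by (simp add: wedge_assoc)
next
  case (add a b)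
  then show ?case by (simp add: wedge_eadd_right Ideal.add)
qed

lemma Ideal_Rel_wedge:
  assumes "r \<in> Rel n" "y \<in> Ext n"
  shows "wedge r y \<in> Ideal n"
proof -
  have "wedge one r = r"
    using Ext_finite[OF Rel_Ext[OF assms(1)]] by (rule wedge_one_left)
  then show ?thesis using Ideal.gen[OF assms(1) one_Ext assms(2)] by simp
qed

lemma cgspan_Ideal: "a \<in> Ideal n \<Longrightarrow> a \<in> cgspan n"
  unfolding cgspan_def by (auto intro!: exI[of _ "\<lambda>_. 0"] simp: esub_def)

lemma cgspan_eadd:
  assumes "a \<in> cgspan n" "b \<in> cgspan n"
  shows "eadd a b \<in> cgspan n"
proof -
  obtain c d where "esub a (\<lambda>S. \<Sum>P\<in>chain_gangs n. c P * cg_mono P S) \<in> Ideal n"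
    "esub b (\<lambda>S. \<Sum>P\<in>chain_gangs n. d P * cg_mono P S) \<in> Ideal n"
    using assms unfolding cgspan_def by auto
  from Ideal.add[OF this] show ?thesis
    unfolding cgspan_def
    by (auto intro!: exI[of _ "\<lambda>P. c P + d P"] simp: esub_def eadd_def sum.distrib algebra_simps)
qed

lemma cgspan_scl:
  assumes "a \<in> cgspan n"
  shows "scl t a \<in> cgspan n"
proof -
  obtain c where "esub a (\<lambda>S. \<Sum>P\<in>chain_gangs n. c P * cg_mono P S) \<in> Ideal n"
    using assms unfolding cgspan_def by auto
  from Ideal_scl[OF this, of t] show ?thesis
    unfolding cgspan_def
    by (auto intro!: exI[of _ "\<lambda>P. t * c P"] simp: esub_def scl_def sum_distrib_left algebra_simps)
qed

lemma cgspan_scl_iff: "t \<noteq> 0 \<Longrightarrow> scl t a \<in> cgspan n \<longleftrightarrow> a \<in> cgspan n"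
  using cgspan_scl[of a n t] cgspan_scl[of "scl t a" n "1 / t"] by auto

lemma cgspan_sum:
  assumes "finite I" "\<And>i. i \<in> I \<Longrightarrow> f i \<in> cgspan n"
  shows "(\<lambda>S. \<Sum>i\<in>I. c i * f i S) \<in> cgspan n"
  using assms
proof (induction I)
  case empty
  then show ?case by (simp add: cgspan_Ideal Ideal.zero)
next
  case (insert i I)
  then have "eadd (scl (c i) (f i)) (\<lambda>S. \<Sum>i\<in>I. c i * f i S) \<in> cgspan n"
    by (intro cgspan_eadd cgspan_scl) auto
  then show ?case using insert by (simp add: eadd_def scl_def)
qed

lemma cgspan_cg_mono:
  assumes "P \<in> chain_gangs n"
  shows "cg_mono P \<in> cgspan n"
proof -
  have "(\<lambda>S. \<Sum>Q\<in>chain_gangs n. (if Q = P then 1 else 0) * cg_mono Q S) = cg_mono P"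
    using assms finite_chain_gangs[of n] by (simp add: if_distrib[of "\<lambda>x. x * _"] cong: if_cong)
  moreover have "esub (cg_mono P) (cg_mono P) \<in> Ideal n"
    by (simp add: esub_def Ideal.zero)
  ultimately show ?thesis unfolding cgspan_def
    by (auto intro!: exI[of _ "\<lambda>Q. if Q = P then 1 else 0"])
qed

text \<open>A relation \<open>a = b - c\<close> modulo the ideal can be solved for \<open>a\<close>
  or for \<open>b\<close>.\<close>

lemma cgspan_rel:
  assumes "esub a (esub b c) \<in> Ideal n"
  shows "b \<in> cgspan n \<Longrightarrow> c \<in> cgspan n \<Longrightarrow> a \<in> cgspan n"
    and "a \<in> cgspan n \<Longrightarrow> c \<in> cgspan n \<Longrightarrow> b \<in> cgspan n"
proof -
  have r: "esub a (esub b c) \<in> cgspan n" using assms by (rule cgspan_Ideal)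
  show "a \<in> cgspan n" if "b \<in> cgspan n" "c \<in> cgspan n"
    using cgspan_eadd[OF r cgspan_eadd[OF that(1) cgspan_scl[OF that(2), of "-1"]]]
    by (simp add: eadd_def esub_def scl_def)
  show "b \<in> cgspan n" if "a \<in> cgspan n" "c \<in> cgspan n"
    using cgspan_eadd[OF cgspan_scl[OF r, of "-1"] cgspan_eadd[OF that]]
    by (simp add: eadd_def esub_def scl_def algebra_simps)
qed

text \<open>The scalar is 0 when an edge is repeated. Its being nonzero matters only for the
  monomial that a relation is being solved for, hence the separate conditional claim.\<close>

lemma wedge_gen_gen_bas:
  assumes "finite S"
  obtains t where "wedge (wedge (gen i j) (gen k l)) (bas S) = scl t (bas (insert (i,j) (insert (k,l) S)))"
    and "(i,j) \<noteq> (k,l) \<Longrightarrow> (i,j) \<notin> S \<Longrightarrow> (k,l) \<notin> S \<Longrightarrow> t \<noteq> 0"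
proof
  show "wedge (wedge (gen i j) (gen k l)) (bas S)
     = scl (wsign {(i,j)} {(k,l)} * wsign {(i,j),(k,l)} S) (bas (insert (i,j) (insert (k,l) S)))"
    using assms by (simp add: gen_eq_bas wedge_bas wedge_scl_left insert_commute)
  show "wsign {(i,j)} {(k,l)} * wsign {(i,j),(k,l)} S \<noteq> 0"
    if "(i,j) \<noteq> (k,l)" "(i,j) \<notin> S" "(k,l) \<notin> S"
    using that by (simp add: wsign_nonzero)
qed

section \<open>Relations as rewriting rules on edge sets\<close>

abbreviation good :: "nat \<Rightarrow> (nat \<times> nat) set \<Rightarrow> bool" where
  "good n S \<equiv> bas S \<in> cgspan n"

lemma good_two_cycle:
  assumes "S \<subseteq> Gen n" "(i,j) \<in> S" "(j,i) \<in> S"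
  shows "good n S"
proof -
  let ?S = "S - {(i,j), (j,i)}"
  have ij: "i \<in> {1..n}" "j \<in> {1..n}" "i \<noteq> j" using assms by (auto simp: Gen_def)
  have "wedge (gen i j) (gen j i) \<in> Rel n" using ij unfolding Rel_def by blast
  moreover have "bas ?S \<in> Ext n" using assms by (intro bas_Ext) auto
  ultimately have I: "wedge (wedge (gen i j) (gen j i)) (bas ?S) \<in> Ideal n"
    by (rule Ideal_Rel_wedge)
  have "finite ?S" using assms finite_Gen finite_subset by blast
  then obtain t where t: "wedge (wedge (gen i j) (gen j i)) (bas ?S)
      = scl t (bas (insert (i,j) (insert (j,i) ?S)))"
    "(i,j) \<noteq> (j,i) \<Longrightarrow> (i,j) \<notin> ?S \<Longrightarrow> (j,i) \<notin> ?S \<Longrightarrow> t \<noteq> 0"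
    using wedge_gen_gen_bas[of ?S i j j i] by blast
  have "insert (i,j) (insert (j,i) ?S) = S" using assms by auto
  moreover have "t \<noteq> 0" using t(2) ij by auto
  ultimately show ?thesis using I t(1) cgspan_Ideal cgspan_scl_iff by metis
qed

text \<open>The relation for two edges leaving \<open>i\<close>, multiplied by \<open>bas S\<close>
  and solved for the fork. If \<open>(j,k)\<close> or \<open>(k,j)\<close> already lies in
  \<open>S\<close>, the corresponding scalar on the other side is 0, which does no harm.\<close>

lemma good_out:
  assumes S: "S \<subseteq> Gen n" and ijk: "i \<in> {1..n}" "j \<in> {1..n}" "k \<in> {1..n}" "i \<noteq> j" "i \<noteq> k" "j \<noteq> k"
    and nin: "(i,j) \<notin> S" "(i,k) \<notin> S"
    and good: "good n (insert (i,j) (insert (j,k) S))" "good n (insert (i,k) (insert (k,j) S))"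
  shows "good n (insert (i,j) (insert (i,k) S))"
proof -
  have fin: "finite S" using S finite_Gen finite_subset by blast
  let ?r = "esub (wedge (gen i j) (gen i k))
          (esub (wedge (gen i j) (gen j k)) (wedge (gen i k) (gen k j)))"
  have "?r \<in> Rel n" using ijk unfolding Rel_def by blast
  then have I: "wedge ?r (bas S) \<in> Ideal n"
    using S by (intro Ideal_Rel_wedge bas_Ext)
  obtain t where t: "wedge (wedge (gen i j) (gen i k)) (bas S) = scl t (bas (insert (i,j) (insert (i,k) S)))"
    "(i,j) \<noteq> (i,k) \<Longrightarrow> (i,j) \<notin> S \<Longrightarrow> (i,k) \<notin> S \<Longrightarrow> t \<noteq> 0"
    using wedge_gen_gen_bas[OF fin] by blast
  obtain u where u: "wedge (wedge (gen i j) (gen j k)) (bas S) = scl u (bas (insert (i,j) (insert (j,k) S)))"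
    using wedge_gen_gen_bas[OF fin] by blast
  obtain v where v: "wedge (wedge (gen i k) (gen k j)) (bas S) = scl v (bas (insert (i,k) (insert (k,j) S)))"
    using wedge_gen_gen_bas[OF fin] by blast
  have "scl t (bas (insert (i,j) (insert (i,k) S))) \<in> cgspan n"
    using I unfolding wedge_esub_left t(1) u v
    by (rule cgspan_rel(1)) (intro cgspan_scl good)+
  moreover have "t \<noteq> 0" using t(2) nin ijk by auto
  ultimately show ?thesis by (simp add: cgspan_scl_iff)
qed

text \<open>The relation for two edges entering \<open>k\<close> is used twice:
  \<open>good_in\<close> solves it for the converging pair, which needs \<open>t\<close> nonzero,
  and \<open>good_path\<close> solves it for the path through \<open>j\<close>, which needs
  \<open>u\<close> nonzero.\<close>

lemma in_relation_bas:
  assumes S: "S \<subseteq> Gen n" and ijk: "i \<in> {1..n}" "j \<in> {1..n}" "k \<in> {1..n}" "i \<noteq> j" "i \<noteq> k" "j \<noteq> k"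
  obtains t u v where
    "esub (scl t (bas (insert (i,k) (insert (j,k) S))))
       (esub (scl u (bas (insert (i,j) (insert (j,k) S)))) (scl v (bas (insert (j,i) (insert (i,k) S))))) \<in> Ideal n"
    "(i,k) \<notin> S \<Longrightarrow> (j,k) \<notin> S \<Longrightarrow> t \<noteq> 0"
    "(i,j) \<notin> S \<Longrightarrow> (j,k) \<notin> S \<Longrightarrow> u \<noteq> 0"
proof -
  have fin: "finite S" using S finite_Gen finite_subset by blast
  let ?r = "esub (wedge (gen i k) (gen j k))
          (esub (wedge (gen i j) (gen j k)) (wedge (gen j i) (gen i k)))"
  have "?r \<in> Rel n" using ijk unfolding Rel_def by blast
  then have I: "wedge ?r (bas S) \<in> Ideal n"
    using S by (intro Ideal_Rel_wedge bas_Ext)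
  obtain t where t: "wedge (wedge (gen i k) (gen j k)) (bas S) = scl t (bas (insert (i,k) (insert (j,k) S)))"
    "(i,k) \<noteq> (j,k) \<Longrightarrow> (i,k) \<notin> S \<Longrightarrow> (j,k) \<notin> S \<Longrightarrow> t \<noteq> 0"
    using wedge_gen_gen_bas[OF fin] by blast
  obtain u where u: "wedge (wedge (gen i j) (gen j k)) (bas S) = scl u (bas (insert (i,j) (insert (j,k) S)))"
    "(i,j) \<noteq> (j,k) \<Longrightarrow> (i,j) \<notin> S \<Longrightarrow> (j,k) \<notin> S \<Longrightarrow> u \<noteq> 0"
    using wedge_gen_gen_bas[OF fin] by blast
  obtain v where v: "wedge (wedge (gen j i) (gen i k)) (bas S) = scl v (bas (insert (j,i) (insert (i,k) S)))"
    using wedge_gen_gen_bas[OF fin] by blast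
  show ?thesis
    using that[OF I[unfolded wedge_esub_left t(1) u(1) v]] t(2) u(2) ijk by auto
qed

lemma good_in:
  assumes "S \<subseteq> Gen n" "i \<in> {1..n}" "j \<in> {1..n}" "k \<in> {1..n}" "i \<noteq> j" "i \<noteq> k" "j \<noteq> k"
    and nin: "(i,k) \<notin> S" "(j,k) \<notin> S"
    and good: "good n (insert (i,j) (insert (j,k) S))" "good n (insert (j,i) (insert (i,k) S))"
  shows "good n (insert (i,k) (insert (j,k) S))"
proof -
  obtain t u v where I: "esub (scl t (bas (insert (i,k) (insert (j,k) S))))
       (esub (scl u (bas (insert (i,j) (insert (j,k) S)))) (scl v (bas (insert (j,i) (insert (i,k) S))))) \<in> Ideal n"
    and t: "t \<noteq> 0"
    using in_relation_bas[OF assms(1-7)] nin by metis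
  have "scl t (bas (insert (i,k) (insert (j,k) S))) \<in> cgspan n"
    using I by (rule cgspan_rel(1)) (intro cgspan_scl good)+
  then show ?thesis using t by (simp add: cgspan_scl_iff)
qed

lemma good_path:
  assumes "S \<subseteq> Gen n" "i \<in> {1..n}" "j \<in> {1..n}" "k \<in> {1..n}" "i \<noteq> j" "i \<noteq> k" "j \<noteq> k"
    and nin: "(i,j) \<notin> S" "(j,k) \<notin> S"
    and good: "good n (insert (i,k) (insert (j,k) S))" "good n (insert (j,i) (insert (i,k) S))"
  shows "good n (insert (i,j) (insert (j,k) S))"
proof -
  obtain t u v where I: "esub (scl t (bas (insert (i,k) (insert (j,k) S))))
       (esub (scl u (bas (insert (i,j) (insert (j,k) S)))) (scl v (bas (insert (j,i) (insert (i,k) S))))) \<in> Ideal n"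
    and u: "u \<noteq> 0"
    using in_relation_bas[OF assms(1-7)] nin by metis
  have "scl u (bas (insert (i,j) (insert (j,k) S))) \<in> cgspan n"
    using I by (rule cgspan_rel(2)) (intro cgspan_scl good)+
  then show ?thesis using u by (simp add: cgspan_scl_iff)
qed

text \<open>Two branches \<open>X\<close> and \<open>Y\<close> leave the vertex \<open>p\<close>.
  The relation makes the first vertex of one branch the next fork, so the total branch length drops
  until one branch is empty. What results is a linear arrangement of both branches, and the last
  hypothesis covers all of these.\<close>

lemma good_merge_out:
  assumes "rest \<subseteq> Gen n" "distinct (A @ p # X @ Y)" "set (A @ p # X @ Y) \<subseteq> {1..n}"
    and "\<And>u v. u \<in> set (A @ p # X @ Y) \<Longrightarrow> v \<in> set (A @ p # X @ Y) \<Longrightarrow> (u,v) \<notin> rest"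
    and "\<And>Z. distinct Z \<Longrightarrow> set Z = set X \<union> set Y \<Longrightarrow> good n (rest \<union> pset (A @ p # Z))"
  shows "good n (rest \<union> pset (A @ p # X) \<union> pset (p # Y))"
  using assms(2-)
proof (induction "length X + length Y" arbitrary: A p X Y rule: less_induct)
  case less
  note dist = less.prems(1) and ran = less.prems(2) and disj = less.prems(3) and H = less.prems(4)
  consider "X = []" | "Y = []" | x X' y Y' where "X = x # X'" "Y = y # Y'"
    by (meson list.exhaust)
  then show ?case
  proof cases
    case 1
    then show ?thesis using H[of Y] dist by (simp add: pset_append[of A p Y] Un_ac)
  next
    case 2
    then show ?thesis using H[of X] dist by simp
  next
    case 3
    \<comment> \<open>\<open>S\<close> is the monomial without the two edges that leave the
      fork.\<close>
    define S where "S = rest \<union> pset (A @ [p]) \<union> pset (x # X') \<union> pset (y # Y')"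
    have "pset (A @ [p]) \<subseteq> Gen n" "pset (x # X') \<subseteq> Gen n" "pset (y # Y') \<subseteq> Gen n"
      using dist ran 3 by (intro pset_Gen; auto)+
    then have S: "S \<subseteq> Gen n" using assms(1) by (auto simp: S_def)
    \<comment> \<open>The fork moves to \<open>x\<close>, with branches \<open>X'\<close> and
      \<open>y # Y'\<close>; below it moves to \<open>y\<close> instead.\<close>
    have "good n (rest \<union> pset ((A @ [p]) @ x # X') \<union> pset (x # y # Y'))"
    proof (rule less.hyps)
      fix Z assume "distinct Z" "set Z = set X' \<union> set (y # Y')"
      then show "good n (rest \<union> pset ((A @ [p]) @ x # Z))"
        using H[of "x # Z"] dist 3 by auto
    qed (use dist ran disj 3 in auto)
    moreover have "rest \<union> pset ((A @ [p]) @ x # X') \<union> pset (x # y # Y') = insert (p,x) (insert (x,y) S)"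
      using pset_append[of A p "x # X'"] by (auto simp: S_def)
    ultimately have g1: "good n (insert (p,x) (insert (x,y) S))" by simp
    have "good n (rest \<union> pset ((A @ [p]) @ y # x # X') \<union> pset (y # Y'))"
    proof (rule less.hyps)
      fix Z assume "distinct Z" "set Z = set (x # X') \<union> set Y'"
      then show "good n (rest \<union> pset ((A @ [p]) @ y # Z))"
        using H[of "y # Z"] dist 3 by auto
    qed (use dist ran disj 3 in auto)
    moreover have "rest \<union> pset ((A @ [p]) @ y # x # X') \<union> pset (y # Y') = insert (p,y) (insert (y,x) S)"
      using pset_append[of A p "y # x # X'"] by (auto simp: S_def)
    ultimately have g2: "good n (insert (p,y) (insert (y,x) S))" by simp
    \<comment> \<open>The edges to be divided out are new: \<open>p\<close> ends the path
      \<open>A @ [p]\<close>, does not occur in either branch, and \<open>rest\<close> has no edges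
      among these vertices.\<close>
    have "(p, v) \<notin> S" if "v \<in> {x, y}" for v
      using that dist disj[of p v] 3 pset_vertices[of p v "A @ [p]"]
        pset_in_set[of p v "x # X'"] pset_in_set[of p v "y # Y'"]
      by (auto simp: S_def)
    then have "good n (insert (p,x) (insert (p,y) S))"
      using dist ran 3 g1 g2 by (intro good_out[OF S]) auto
    moreover have "rest \<union> pset (A @ p # X) \<union> pset (p # Y) = insert (p,x) (insert (p,y) S)"
      using pset_append[of A p "x # X'"] 3 by (auto simp: S_def)
    ultimately show ?thesis by simp
  qed
qed

text \<open>The mirror image of \<open>good_merge_out\<close>: two branches flow into
  \<open>p\<close>, and the meeting point moves backwards, so the lists are peeled from their
  ends.\<close>

lemma good_merge_in:
  assumes "rest \<subseteq> Gen n" "distinct (X @ Y @ p # B)" "set (X @ Y @ p # B) \<subseteq> {1..n}"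
    and "\<And>u v. u \<in> set (X @ Y @ p # B) \<Longrightarrow> v \<in> set (X @ Y @ p # B) \<Longrightarrow> (u,v) \<notin> rest"
    and "\<And>Z. distinct Z \<Longrightarrow> set Z = set X \<union> set Y \<Longrightarrow> good n (rest \<union> pset (Z @ p # B))"
  shows "good n (rest \<union> pset (X @ p # B) \<union> pset (Y @ [p]))"
  using assms(2-)
proof (induction "length X + length Y" arbitrary: B p X Y rule: less_induct)
  case less
  note dist = less.prems(1) and ran = less.prems(2) and disj = less.prems(3) and H = less.prems(4)
  consider "X = []" | "Y = []" | x X' y Y' where "X = X' @ [x]" "Y = Y' @ [y]"
    by (meson rev_exhaust)
  then show ?case
  proof cases
    case 1
    then show ?thesis using H[of Y] dist by (simp add: pset_append[of Y p B] Un_ac)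
  next
    case 2
    then show ?thesis using H[of X] dist by simp
  next
    case 3
    define S where "S = rest \<union> pset (p # B) \<union> pset (X' @ [x]) \<union> pset (Y' @ [y])"
    have "pset (p # B) \<subseteq> Gen n" "pset (X' @ [x]) \<subseteq> Gen n" "pset (Y' @ [y]) \<subseteq> Gen n"
      using dist ran 3 by (intro pset_Gen; auto)+
    then have S: "S \<subseteq> Gen n" using assms(1) by (auto simp: S_def)
    have "good n (rest \<union> pset ((X' @ [x]) @ y # p # B) \<union> pset (Y' @ [y]))"
    proof (rule less.hyps)
      fix Z assume "distinct Z" "set Z = set (X' @ [x]) \<union> set Y'"
      then show "good n (rest \<union> pset (Z @ y # p # B))"
        using H[of "Z @ [y]"] dist 3 by auto
    qed (use dist ran disj 3 in auto)
    moreover have "rest \<union> pset ((X' @ [x]) @ y # p # B) \<union> pset (Y' @ [y]) = insert (x,y) (insert (y,p) S)"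
      using pset_append[of "X' @ [x]" y "p # B"] pset_snoc[of X' x y] by (auto simp: S_def)
    ultimately have g1: "good n (insert (x,y) (insert (y,p) S))" by simp
    have "good n (rest \<union> pset (X' @ x # p # B) \<union> pset ((Y' @ [y]) @ [x]))"
    proof (rule less.hyps)
      fix Z assume "distinct Z" "set Z = set X' \<union> set (Y' @ [y])"
      then show "good n (rest \<union> pset (Z @ x # p # B))"
        using H[of "Z @ [x]"] dist 3 by auto
    qed (use dist ran disj 3 in auto)
    moreover have "rest \<union> pset (X' @ x # p # B) \<union> pset ((Y' @ [y]) @ [x]) = insert (y,x) (insert (x,p) S)"
      using pset_append[of X' x "p # B"] pset_snoc[of Y' y x] by (auto simp: S_def)
    ultimately have g2: "good n (insert (y,x) (insert (x,p) S))" by simp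
    have "(v, p) \<notin> S" if "v \<in> {x, y}" for v
      using that dist disj[of v p] 3 pset_vertices[of v p "p # B"]
        pset_in_set[of v p "X' @ [x]"] pset_in_set[of v p "Y' @ [y]"]
      by (auto simp: S_def)
    then have "good n (insert (x,p) (insert (y,p) S))"
      using dist ran 3 g1 g2 by (intro good_in[OF S]) auto
    moreover have "rest \<union> pset (X @ p # B) \<union> pset (Y @ [p]) = insert (x,p) (insert (y,p) S)"
      using pset_append[of X' x "p # B"] pset_snoc[of Y' y p] 3 by (auto simp: S_def)
    ultimately show ?thesis by simp
  qed
qed

text \<open>The relation behind \<open>good_path\<close> shortcuts \<open>b\<close>, the successor
  of \<open>a\<close>, so the cycle shrinks until it is a two-cycle, whose monomial lies in the
  ideal.\<close>

lemma good_cycle: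
  assumes "distinct (a # D @ [z])" "set (a # D @ [z]) \<subseteq> {1..n}" "S \<subseteq> Gen n"
    and "pset (a # D @ [z]) \<subseteq> S" "(z, a) \<in> S"
  shows "good n S"
  using assms
proof (induction D arbitrary: a S)
  case Nil
  then show ?case using good_two_cycle[of S n a z] by auto
next
  case (Cons b D)
  \<comment> \<open>\<open>c\<close> is the vertex after \<open>b\<close> on the cycle; it is
    \<open>z\<close> itself when \<open>D\<close> is empty.\<close>
  obtain c E where E: "D @ [z] = c # E" by (cases "D @ [z]") auto
  define S0 where "S0 = S - {(a,b), (b,c)}"
  have abc: "a \<noteq> b" "a \<noteq> c" "b \<noteq> c" "{a, b, c} \<subseteq> {1..n}"
    using Cons.prems(1,2) E by auto
  then have G: "(a,c) \<in> Gen n" "(b,a) \<in> Gen n" "(b,c) \<in> Gen n" by (auto simp: Gen_def)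
  have S: "S = insert (a,b) (insert (b,c) S0)"
    using Cons.prems(4) E by (auto simp: S0_def)
  have S0: "S0 \<subseteq> Gen n" using Cons.prems(3) by (auto simp: S0_def)
  have "z \<in> set (c # E)" unfolding E[symmetric] by simp
  then have za: "(z, a) \<in> S0" using Cons.prems(1,5) E by (auto simp: S0_def)
  have "pset (c # E) \<subseteq> S0"
    using Cons.prems(1,4) E pset_in_set[of a b "c # E"] pset_in_set[of b c "c # E"]
    by (auto simp: S0_def)
  then have sub: "pset (a # D @ [z]) \<subseteq> insert (a,c) S0" unfolding E by auto
  \<comment> \<open>Both replacement monomials contain \<open>(a,c)\<close> and hence the cycle that
    bypasses \<open>b\<close>, so one application of the induction hypothesis serves both.\<close>
  have *: "good n T" if "insert (a,c) S0 \<subseteq> T" "T \<subseteq> Gen n" for T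
    using Cons.prems(1,2) that sub za by (intro Cons.IH[of a]) auto
  show ?case unfolding S
  proof (rule good_path[OF S0])
    show "good n (insert (a,c) (insert (b,c) S0))" "good n (insert (b,a) (insert (a,c) S0))"
      using S0 G by (auto intro!: *)
  qed (use abc in \<open>auto simp: S0_def\<close>)
qed

text \<open>The chord \<open>(i,j)\<close> and the path edge \<open>(i,k)\<close> form a fork at
  \<open>i\<close>. One replacement has the shorter chord \<open>(k,j)\<close>; the other has the
  edge \<open>(j,k)\<close>, which closes the segment from \<open>k\<close> to \<open>j\<close> to a
  cycle.\<close>

lemma good_chord:
  assumes "distinct (A @ i # M @ j # B)" "set (A @ i # M @ j # B) \<subseteq> {1..n}" "rest \<subseteq> Gen n"
    and "\<And>u v. u \<in> set (A @ i # M @ j # B) \<Longrightarrow> v \<in> set (A @ i # M @ j # B) \<Longrightarrow> (u,v) \<notin> rest"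
    and "good n (rest \<union> pset (A @ i # M @ j # B))"
  shows "good n (insert (i,j) (rest \<union> pset (A @ i # M @ j # B)))"
  using assms
proof (induction M arbitrary: A i)
  case Nil
  \<comment> \<open>With no vertex in between, the chord is already an edge of the path.\<close>
  have "(i,j) \<in> pset (A @ i # j # B)" using pset_append[of A i "j # B"] by simp
  then show ?case using Nil by (simp add: insert_absorb)
next
  case (Cons k M)
  note dist = Cons.prems(1) and ran = Cons.prems(2) and disj = Cons.prems(4)
  define S where "S = rest \<union> pset (A @ [i]) \<union> pset (k # M @ j # B)"
  have "pset (A @ [i]) \<subseteq> Gen n" "pset (k # M @ j # B) \<subseteq> Gen n"
    using dist ran by (intro pset_Gen; auto)+
  then have S: "S \<subseteq> Gen n" using Cons.prems(3) by (auto simp: S_def)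
  have eq: "rest \<union> pset (A @ i # (k # M) @ j # B) = insert (i,k) S"
    using pset_append[of A i "k # M @ j # B"] by (auto simp: S_def)
  have "good n (insert (k,j) (rest \<union> pset ((A @ [i]) @ k # M @ j # B)))"
    by (rule Cons.IH) (use Cons.prems in auto)
  then have g1: "good n (insert (i,k) (insert (k,j) S))"
    using eq by (simp add: insert_commute)
  have "pset (k # M @ [j]) \<subseteq> S"
    using pset_append[of "k # M" j B] by (auto simp: S_def)
  moreover have "(j,k) \<in> Gen n" "(i,j) \<in> Gen n" using dist ran by (auto simp: Gen_def)
  ultimately have g2: "good n (insert (i,j) (insert (j,k) S))"
    using dist ran S by (intro good_cycle[of k M j n]) auto
  have "(i, v) \<notin> S" if "v \<in> {j, k}" for v
    using that dist disj[of i v] pset_vertices[of i v "A @ [i]"] pset_in_set[of i v "k # M @ j # B"]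
    by (auto simp: S_def)
  then have "good n (insert (i,j) (insert (i,k) S))"
    using dist ran g1 g2 by (intro good_out[OF S]) auto
  then show ?case unfolding eq .
qed

section \<open>Inserting an edge into a chain gang\<close>

lemma good_chain_gang:
  assumes "P \<in> chain_gangs n"
  shows "good n (gang_edges P)"
proof -
  obtain s where "s \<noteq> 0" "cg_mono P = scl s (bas (gang_edges P))"
    using cg_mono_eq_bas[OF assms] by auto
  then show ?thesis using cgspan_cg_mono[OF assms] by (simp add: cgspan_scl_iff)
qed

lemma good_insert_same_block:
  assumes P: "P \<in> chain_gangs n" and b: "b \<in> P" "i \<in> set b" "j \<in> set b" and ij: "i \<noteq> j"
  shows "good n (insert (i,j) (gang_edges P))"
proof -
  define rest where "rest = gang_edges (P - {b})"
  have eq: "gang_edges P = rest \<union> pset b" using b by (auto simp: rest_def gang_edges_def)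
  have G: "gang_edges P \<subseteq> Gen n" using P by (rule gang_edges_Gen)
  have disj: "(u,v) \<notin> rest" if "u \<in> set b" "v \<in> set b" for u v
    using that b gang_edges_Diff_vertices[OF P] by (auto simp: rest_def)
  have dist: "distinct b" and ran: "set b \<subseteq> {1..n}" using chain_gangD[OF P] b by auto
  obtain A C where AC: "b = A @ i # C" using b split_list by metis
  \<comment> \<open>If \<open>j\<close> comes after \<open>i\<close>, the new edge is a forward
    chord; if it comes before, the new edge closes a directed cycle.\<close>
  then consider "j \<in> set C" | "j \<in> set A" using b ij by auto
  then show ?thesis
  proof cases
    case 1
    then obtain M B where "b = A @ i # M @ j # B" using AC split_list by metis
    then show ?thesis using good_chord[of A i M j B n rest] dist ran disj good_chain_gang[OF P] eq G
      by auto
  next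
    case 2
    then obtain A1 M where A: "A = A1 @ j # M" using split_list by metis
    have "pset (j # M @ [i]) \<subseteq> pset b"
      using pset_append[of A1 j "M @ i # C"] pset_append[of "j # M" i C] AC A by auto
    moreover have "(i,j) \<in> Gen n" using b ij ran by (auto simp: Gen_def)
    ultimately show ?thesis
      using dist ran G eq AC A by (intro good_cycle[of j M i n]) auto
  qed
qed

text \<open>Every linear order on the union of two blocks is an admissible block, so the merging
  lemmas may forget how their two branches were shuffled.\<close>

lemma chain_gang_merge:
  assumes P: "P \<in> chain_gangs n" and b: "b \<in> P" "c \<in> P"
    and Z: "distinct Z" "set Z = set b \<union> set c"
  shows "insert Z (P - {b,c}) \<in> chain_gangs n"
proof -
  note D = chain_gangD[OF P]
  have "Z \<noteq> []" using Z D(2)[OF b(1)] by auto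
  moreover have "set Z \<inter> set d = {}" if "d \<in> P - {b,c}" for d
  proof -
    have "set d \<inter> set b = {}" "set d \<inter> set c = {}"
      using that D(5)[of d b] D(5)[of d c] b by auto
    then show ?thesis using Z(2) by auto
  qed
  moreover have "(\<Union>d\<in>insert Z (P - {b,c}). set d) = (\<Union>d\<in>P. set d)"
    using Z b by auto
  ultimately show ?thesis
    using P Z unfolding chain_gangs_def by auto
qed

text \<open>The new edge makes two paths meet at \<open>j\<close> and two paths part at
  \<open>i\<close>. Merging first the parts before \<open>j\<close> and then the parts after
  \<open>i\<close> turns the two blocks into one.\<close>

lemma good_insert_other_block:
  assumes P: "P \<in> chain_gangs n" and b: "b \<in> P" "c \<in> P" "b \<noteq> c" and ij: "i \<in> set b" "j \<in> set c"
  shows "good n (insert (i,j) (gang_edges P))"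
proof -
  note D = chain_gangD[OF P]
  define rest where "rest = gang_edges (P - {b,c})"
  obtain A1 A2 where A: "b = A1 @ i # A2" using ij split_list by metis
  obtain B1 B2 where B: "c = B1 @ j # B2" using ij split_list by metis
  have dist: "distinct (b @ c)" and ran: "set (b @ c) \<subseteq> {1..n}"
    using D(3-4) D(5)[OF b(1,2)] b by auto
  have rest: "rest \<subseteq> Gen n"
    using gang_edges_Gen[OF P] by (auto simp: rest_def gang_edges_def)
  have disj: "(u,v) \<notin> rest" if "u \<in> set (b @ c)" for u v
    using that b gang_edges_Diff_vertices[OF P, of u v "{b,c}"] by (auto simp: rest_def)
  have fin: "good n (rest \<union> pset Z)" if "distinct Z" "set Z = set (b @ c)" for Z
    using good_chain_gang[OF chain_gang_merge[OF P b(1,2)]] that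
    by (simp add: rest_def gang_edges_def Un_commute)
  have "pset (i # A2) \<subseteq> Gen n" using dist ran A by (intro pset_Gen) auto
  then have rest2: "rest \<union> pset (i # A2) \<subseteq> Gen n" using rest by simp
  \<comment> \<open>The tail leaving \<open>i\<close> is set aside with \<open>rest\<close>, so only
    the meeting point \<open>j\<close> is treated here.\<close>
  have "good n ((rest \<union> pset (i # A2)) \<union> pset ((A1 @ [i]) @ j # B2) \<union> pset (B1 @ [j]))"
  proof (rule good_merge_in[OF rest2])
    fix u v
    assume "u \<in> set ((A1 @ [i]) @ B1 @ j # B2)" "v \<in> set ((A1 @ [i]) @ B1 @ j # B2)"
    then show "(u,v) \<notin> rest \<union> pset (i # A2)"
      using disj[of u v] dist A B pset_vertices[of u v "i # A2"] by auto
  next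
    fix Z assume Z: "distinct Z" "set Z = set (A1 @ [i]) \<union> set B1"
    then obtain Z1 Z2 where Z12: "Z = Z1 @ i # Z2" using split_list[of i Z] by auto
    have "set Z1 \<union> set Z2 \<subseteq> set A1 \<union> set B1" using Z Z12 by auto
    then have sets: "set A1 \<union> set B1 = set Z1 \<union> set Z2" using Z Z12 dist A B by auto
    \<comment> \<open>The vertex \<open>i\<close> now sits somewhere in \<open>Z\<close>; leaving it
      are the remainder \<open>Z2 @ j # B2\<close> of the merged path and the tail
      \<open>A2\<close>.\<close>
    have "good n (rest \<union> pset (Z1 @ i # Z2 @ j # B2) \<union> pset (i # A2))"
    proof (rule good_merge_out[OF rest])
      show "distinct (Z1 @ i # (Z2 @ j # B2) @ A2)"
        using Z Z12 sets dist A B by auto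
      show "set (Z1 @ i # (Z2 @ j # B2) @ A2) \<subseteq> {1..n}"
        using sets ran A B by auto
      show "(u,v) \<notin> rest" if "u \<in> set (Z1 @ i # (Z2 @ j # B2) @ A2)" for u v
        using that sets A B by (intro disj) auto
      show "good n (rest \<union> pset (Z1 @ i # Y))" if "distinct Y" "set Y = set (Z2 @ j # B2) \<union> set A2" for Y
        using that sets A B Z Z12 dist by (intro fin) auto
    qed
    then show "good n (rest \<union> pset (i # A2) \<union> pset (Z @ j # B2))"
      by (simp add: Z12 Un_ac)
  qed (use dist ran A B in auto)
  moreover have "(rest \<union> pset (i # A2)) \<union> pset ((A1 @ [i]) @ j # B2) \<union> pset (B1 @ [j])
      = insert (i,j) (gang_edges P)"
  proof -
    have "gang_edges P = rest \<union> pset b \<union> pset c" using b by (auto simp: rest_def gang_edges_def)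
    then show ?thesis
      using pset_append[of A1 i A2] pset_append[of B1 j B2] pset_append[of A1 i "j # B2"] A B by auto
  qed
  ultimately show ?thesis by simp
qed

lemma good_insert_gang_edges:
  assumes P: "P \<in> chain_gangs n" and "(i,j) \<in> Gen n"
  shows "good n (insert (i,j) (gang_edges P))"
proof -
  have ij: "i \<in> {1..n}" "j \<in> {1..n}" "i \<noteq> j" using assms by (auto simp: Gen_def)
  obtain b c where "b \<in> P" "c \<in> P" "i \<in> set b" "j \<in> set c"
    using chain_gangD(6)[OF P] ij by metis
  then show ?thesis
    using good_insert_same_block[OF P] good_insert_other_block[OF P] ij by metis
qed

text \<open>Left multiplication by generators suffices for spanning, since each monomial is built
  from the empty one in this way. It preserves the ideal and otherwise inserts one edge into a chain
  gang.\<close>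

lemma wedge_gen_cgspan:
  assumes a: "a \<in> cgspan n" and ij: "(i,j) \<in> Gen n"
  shows "wedge (gen i j) a \<in> cgspan n"
proof -
  obtain c where c: "esub a (\<lambda>S. \<Sum>P\<in>chain_gangs n. c P * cg_mono P S) \<in> Ideal n"
    using a unfolding cgspan_def by auto
  have "gen i j \<in> Ext n" using ij by (simp add: gen_eq_bas bas_Ext)
  with c have "wedge (gen i j) (esub a (\<lambda>S. \<Sum>P\<in>chain_gangs n. c P * cg_mono P S)) \<in> Ideal n"
    by (rule Ideal_wedge_left)
  then have 1: "esub (wedge (gen i j) a) (\<lambda>S. \<Sum>P\<in>chain_gangs n. c P * wedge (gen i j) (cg_mono P) S) \<in> cgspan n"
    unfolding wedge_esub_right wedge_sum_right by (rule cgspan_Ideal)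
  have "wedge (gen i j) (cg_mono P) \<in> cgspan n" if P: "P \<in> chain_gangs n" for P
  proof -
    obtain s where s: "cg_mono P = scl s (bas (gang_edges P))"
      using cg_mono_eq_bas[OF P] by auto
    have "finite (gang_edges P)" using gang_edges_Gen[OF P] finite_Gen finite_subset by blast
    then show ?thesis using good_insert_gang_edges[OF P ij]
      by (simp add: s gen_eq_bas wedge_scl_right wedge_bas cgspan_scl)
  qed
  then have "(\<lambda>S. \<Sum>P\<in>chain_gangs n. c P * wedge (gen i j) (cg_mono P) S) \<in> cgspan n"
    by (intro cgspan_sum finite_chain_gangs)
  from cgspan_eadd[OF 1 this] show ?thesis by (simp add: eadd_def esub_def)
qed

lemma good_empty: "good n {}"
proof -
  \<comment> \<open>The partition into singletons has no edges.\<close>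
  have "(\<lambda>i. [i]) ` {1..n} \<in> chain_gangs n" by (auto simp: chain_gangs_def)
  from good_chain_gang[OF this] show ?thesis by (simp add: gang_edges_def)
qed

lemma good_all:
  assumes "S \<subseteq> Gen n"
  shows "good n S"
  using finite_subset[OF assms finite_Gen] assms
proof (induction S)
  case empty
  show ?case by (rule good_empty)
next
  case (insert e S)
  obtain i j where e: "e = (i,j)" by fastforce
  have "wedge (gen i j) (bas S) \<in> cgspan n" using insert e by (intro wedge_gen_cgspan) auto
  moreover have "wedge (gen i j) (bas S) = scl (wsign {e} S) (bas (insert e S))"
    using insert e by (simp add: gen_eq_bas wedge_bas)
  moreover have "wsign {e} S \<noteq> 0" using insert by (intro wsign_nonzero) auto
  ultimately show ?case by (simp add: cgspan_scl_iff)
qed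

lemma Ext_cgspan:
  assumes "a \<in> Ext n"
  shows "a \<in> cgspan n"
proof -
  have "(\<lambda>T. \<Sum>S\<in>Pow (Gen n). a S * bas S T) \<in> cgspan n"
    using finite_Gen by (intro cgspan_sum good_all) auto
  then show ?thesis using Ext_decomp[OF assms] by simp
qed

section \<open>Homomorphisms out of the exterior algebra\<close>

text \<open>Elements of degree 1. The generators are not restricted to \<open>Gen n\<close>, because
  the interval forms below use the pairs \<open>(v,v)\<close>.\<close>

definition linear_form :: "ext \<Rightarrow> bool" where
  "linear_form a \<longleftrightarrow> (\<forall>S. a S \<noteq> 0 \<longrightarrow> (\<exists>x. S = {x}))"

lemma wedge_anticomm:
  assumes "linear_form a" "linear_form b"
  shows "wedge a b = scl (-1) (wedge b a)"
proof
  fix U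
  have "wedge a b U = (\<Sum>S\<in>Pow U. a (U - S) * b S * wsign (U - S) S)"
    unfolding wedge_def
    by (rule sum.reindex_bij_witness[where i="\<lambda>S. U - S" and j="\<lambda>S. U - S"]) (auto simp: double_diff)
  also have "\<dots> = (\<Sum>S\<in>Pow U. - (b S * a (U - S) * wsign S (U - S)))"
  proof (rule sum.cong)
    fix S assume "S \<in> Pow U"
    show "a (U - S) * b S * wsign (U - S) S = - (b S * a (U - S) * wsign S (U - S))"
    proof (cases "a (U - S) = 0 \<or> b S = 0")
      case False
      then obtain x y where xy: "U - S = {x}" "S = {y}"
        using assms unfolding linear_form_def by meson
      then have "x \<noteq> y" by auto
      then show ?thesis unfolding xy(1) unfolding xy(2) by (auto simp: wsign_singleton)
    qed auto
  qed simp
  also have "\<dots> = scl (-1) (wedge b a) U"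
    by (simp add: wedge_def scl_def sum_negf)
  finally show "wedge a b U = scl (-1) (wedge b a) U" .
qed

text \<open>Anticommutation equates the square with its negative, and 2 is invertible in the
  rationals.\<close>

lemma wedge_self:
  assumes "linear_form a"
  shows "wedge a a = (\<lambda>S. 0)"
proof
  fix S
  have "wedge a a S = - wedge a a S"
    using fun_cong[OF wedge_anticomm[OF assms assms], of S] by (simp add: scl_def)
  then show "wedge a a S = 0" by simp
qed

lemma wsign_less:
  assumes "\<And>t. t \<in> T \<Longrightarrow> s < t"
  shows "wsign {s} T = 1"
proof -
  have "{(x,t). x \<in> {s} \<and> t \<in> T \<and> t < x} = {}" "{s} \<inter> T = {}"
    using assms less_asym by blast+
  then show ?thesis unfolding wsign_def by (simp only: card.empty power_0 if_True simp_thms)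
qed

lemma eadd_zero [simp]: "eadd (\<lambda>S. 0) a = a" "eadd a (\<lambda>S. 0) = a"
  by (simp_all add: eadd_def)

text \<open>The intended image of \<open>bas S\<close> when each generator \<open>e\<close> is sent
  to \<open>f e\<close>; the factors follow the increasing order that \<open>wsign\<close>
  presupposes.\<close>

definition oprod :: "(nat \<times> nat \<Rightarrow> ext) \<Rightarrow> (nat \<times> nat) set \<Rightarrow> ext" where
  "oprod f S = foldr (\<lambda>e. wedge (f e)) (sorted_list_of_set S) one"

lemma oprod_empty [simp]: "oprod f {} = one"
  by (simp add: oprod_def)

lemma oprod_insert_min:
  assumes "finite A" "\<And>a. a \<in> A \<Longrightarrow> b < a"
  shows "oprod f (insert b A) = wedge (f b) (oprod f A)"
proof -
  have "b \<notin> A" using assms by blast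
  then have "sorted_list_of_set (insert b A) = insort b (sorted_list_of_set A)"
    using assms by simp
  also have "\<dots> = b # sorted_list_of_set A"
    using assms by (intro insort_is_Cons) (auto intro: less_imp_le)
  finally show ?thesis by (simp add: oprod_def)
qed

lemma oprod_finite: "oprod f S V \<noteq> 0 \<Longrightarrow> finite V"
  unfolding oprod_def
  by (cases "sorted_list_of_set S") (use wedge_infinite in \<open>auto simp: one_def split: if_splits\<close>)

lemma oprod_singleton: "linear_form (f e) \<Longrightarrow> oprod f {e} = f e"
  using oprod_insert_min[of "{}" e f] by (auto simp: linear_form_def intro!: wedge_one_right)

lemma oprod_zero:
  assumes "finite S" "e \<in> S" "f e = (\<lambda>S. 0)"
  shows "oprod f S = (\<lambda>S. 0)"
proof -
  have "e \<in> set xs \<Longrightarrow> foldr (\<lambda>e. wedge (f e)) xs one = (\<lambda>S. 0)" for xs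
    using assms(3) by (induction xs) auto
  then show ?thesis using assms by (simp add: oprod_def)
qed

text \<open>Moving \<open>f s\<close> to its sorted place costs a sign for each smaller factor. If
  \<open>s\<close> already lies in \<open>V\<close>, the repeated linear form kills the product, in
  accordance with \<open>wsign {s} V = 0\<close>.\<close>

lemma wedge_oprod_insert:
  assumes f: "\<And>e. linear_form (f e)" and "finite V"
  shows "wedge (f s) (oprod f V) = scl (wsign {s} V) (oprod f (insert s V))"
  using assms(2)
proof (induction V rule: finite_linorder_min_induct)
  case empty
  then show ?case using f[of s]
    by (auto simp: oprod_singleton wsign_def linear_form_def intro!: wedge_one_right)
next
  case (insert b A)
  have prod: "oprod f (insert b A) = wedge (f b) (oprod f A)"
    using insert by (intro oprod_insert_min) auto
  consider "s < b" | "s = b" | "b < s" by fastforce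
  then show ?case
  proof cases
    case 1
    then have "oprod f (insert s (insert b A)) = wedge (f s) (oprod f (insert b A))"
      using insert by (intro oprod_insert_min) auto
    moreover have "wsign {s} (insert b A) = 1"
      using 1 insert by (intro wsign_less) auto
    ultimately show ?thesis by simp
  next
    case 2
    then have "wsign {s} (insert b A) = 0" by (simp add: wsign_def)
    moreover have "wedge (f b) (wedge (f b) (oprod f A)) = (\<lambda>S. 0)"
      by (simp add: wedge_assoc[symmetric] wedge_self[OF f])
    ultimately show ?thesis by (simp add: prod 2)
  next
    case 3
    have "wedge (f s) (oprod f (insert b A)) = wedge (wedge (f s) (f b)) (oprod f A)"
      by (simp add: prod wedge_assoc)
    also have "\<dots> = scl (-1) (wedge (f b) (wedge (f s) (oprod f A)))"
      by (subst wedge_anticomm[OF f f]) (simp add: wedge_scl_left wedge_assoc)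
    also have "\<dots> = scl (- wsign {s} A) (wedge (f b) (oprod f (insert s A)))"
      by (simp add: insert wedge_scl_right)
    also have "wedge (f b) (oprod f (insert s A)) = oprod f (insert b (insert s A))"
      using insert 3 by (intro oprod_insert_min[symmetric]) auto
    also have "- wsign {s} A = wsign {s} (insert b A)"
      using wsign_Un_right[of "{s}" "{b}" A] insert 3 by (auto simp: wsign_singleton)
    finally show ?thesis by (simp add: insert_commute)
  qed
qed

text \<open>These are the structure constants of the basis \<open>bas\<close>, as in
  \<open>wedge_bas\<close>; this is what makes \<open>Psi\<close> multiplicative.\<close>

lemma wedge_oprod:
  assumes f: "\<And>e. linear_form (f e)" and "finite S" "finite T"
  shows "wedge (oprod f S) (oprod f T) = scl (wsign S T) (oprod f (S \<union> T))"
  using assms(2)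
proof (induction S rule: finite_linorder_min_induct)
  case empty
  have "wedge one (oprod f T) = oprod f T" by (intro wedge_one_left oprod_finite)
  then show ?case by (simp add: wsign_def)
next
  case (insert b A)
  have "wedge (oprod f (insert b A)) (oprod f T) = wedge (f b) (wedge (oprod f A) (oprod f T))"
    using insert by (simp add: oprod_insert_min wedge_assoc)
  also have "\<dots> = scl (wsign A T * wsign {b} (A \<union> T)) (oprod f (insert b A \<union> T))"
    using insert assms by (simp add: wedge_scl_right wedge_oprod_insert[where f=f, OF f])
  also have "wsign A T * wsign {b} (A \<union> T) = wsign (insert b A) T"
  proof (cases "A \<inter> T = {}")
    case True
    have "wsign {b} A = 1" using insert by (intro wsign_less) auto
    moreover have "wsign (insert b A) T = wsign {b} T * wsign A T"
      using wsign_Un_left[of "{b}" A T] insert assms by auto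
    ultimately show ?thesis using wsign_Un_right[of "{b}" A T] True insert assms by simp
  next
    case False
    then show ?thesis by (auto simp: wsign_def)
  qed
  finally show ?case .
qed

text \<open>For linear forms \<open>f e\<close>, this is the algebra homomorphism given by the
  universal property of the exterior algebra. Its values need not lie in
  \<open>Ext n\<close>.\<close>

definition Psi :: "(nat \<times> nat \<Rightarrow> ext) \<Rightarrow> nat \<Rightarrow> ext \<Rightarrow> ext" where
  "Psi f n a = (\<lambda>V. \<Sum>S\<in>Pow (Gen n). a S * oprod f S V)"

lemma Psi_zero [simp]: "Psi f n (\<lambda>S. 0) = (\<lambda>S. 0)"
  by (simp add: Psi_def)

lemma Psi_eadd: "Psi f n (eadd a b) = eadd (Psi f n a) (Psi f n b)"
  by (simp add: Psi_def eadd_def sum.distrib algebra_simps)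

lemma Psi_esub: "Psi f n (esub a b) = esub (Psi f n a) (Psi f n b)"
  by (simp add: Psi_def esub_def sum_subtractf algebra_simps)

lemma Psi_scl: "Psi f n (scl c a) = scl c (Psi f n a)"
  by (simp add: Psi_def scl_def sum_distrib_left mult_ac)

lemma Psi_sum: "Psi f n (\<lambda>S. \<Sum>i\<in>I. c i * g i S) = (\<lambda>S. \<Sum>i\<in>I. c i * Psi f n (g i) S)"
proof
  fix V
  show "Psi f n (\<lambda>S. \<Sum>i\<in>I. c i * g i S) V = (\<Sum>i\<in>I. c i * Psi f n (g i) V)"
    unfolding Psi_def sum_distrib_left sum_distrib_right
    by (subst sum.swap) (simp add: mult.assoc)
qed

lemma Psi_bas:
  assumes "S \<subseteq> Gen n"
  shows "Psi f n (bas S) = oprod f S"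
proof
  fix V
  have "Psi f n (bas S) V = (\<Sum>T\<in>Pow (Gen n). if T = S then oprod f S V else 0)"
    unfolding Psi_def by (rule sum.cong) (auto simp: bas_def)
  then show "Psi f n (bas S) V = oprod f S V" using assms finite_Gen by simp
qed

lemma Psi_wedge:
  assumes f: "\<And>e. linear_form (f e)"
  shows "Psi f n (wedge a b) = wedge (Psi f n a) (Psi f n b)"
proof
  fix V
  have fin: "\<And>S. S \<subseteq> Gen n \<Longrightarrow> finite S" using finite_Gen finite_subset by blast
  have "wedge (Psi f n a) (Psi f n b) V
      = (\<Sum>S\<in>Pow (Gen n). a S * (\<Sum>T\<in>Pow (Gen n). b T * wedge (oprod f S) (oprod f T) V))"
    unfolding Psi_def wedge_sum_left wedge_sum_right ..
  also have "\<dots> = (\<Sum>S\<in>Pow (Gen n). a S * (\<Sum>T\<in>Pow (Gen n - S). b T * wedge (oprod f S) (oprod f T) V))"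
  proof (rule sum.cong[OF refl])
    fix S assume "S \<in> Pow (Gen n)"
    \<comment> \<open>Such a \<open>T\<close> meets \<open>S\<close>, so the structure constant is
      0.\<close>
    then have neutral: "wedge (oprod f S) (oprod f T) V = 0" if "T \<in> Pow (Gen n) - Pow (Gen n - S)" for T
      using that fin wedge_oprod[where f=f, OF f, of S T] by (auto simp: wsign_def)
    have "(\<Sum>T\<in>Pow (Gen n). b T * wedge (oprod f S) (oprod f T) V)
        = (\<Sum>T\<in>Pow (Gen n - S). b T * wedge (oprod f S) (oprod f T) V)"
      by (rule sum.mono_neutral_right) (use finite_Gen neutral in auto)
    then show "a S * (\<Sum>T\<in>Pow (Gen n). b T * wedge (oprod f S) (oprod f T) V)
        = a S * (\<Sum>T\<in>Pow (Gen n - S). b T * wedge (oprod f S) (oprod f T) V)" by simp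
  qed
  also have "\<dots> = (\<Sum>(S,T)\<in>Sigma (Pow (Gen n)) (\<lambda>S. Pow (Gen n - S)).
      a S * (b T * wedge (oprod f S) (oprod f T) V))"
    using finite_Gen by (subst sum.Sigma[symmetric]) (auto simp: sum_distrib_left)
  also have "\<dots> = (\<Sum>(U,S)\<in>Sigma (Pow (Gen n)) Pow. a S * b (U - S) * wsign S (U - S) * oprod f U V)"
  \<comment> \<open>A pair of disjoint sets amounts to their union together with its first part,
    which is how \<open>wedge\<close> indexes its sum.\<close>
  proof (rule sum.reindex_bij_witness[where j="\<lambda>(S,T). (S \<union> T, S)" and i="\<lambda>(U,S). (S, U - S)"], goal_cases)
    case (5 x)
    then obtain S T where x: "x = (S,T)" and ST: "S \<subseteq> Gen n" "T \<subseteq> Gen n - S" by auto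
    then have "S \<union> T - S = T" by auto
    moreover have "wedge (oprod f S) (oprod f T) = scl (wsign S T) (oprod f (S \<union> T))"
      using ST by (intro wedge_oprod f fin) auto
    ultimately show ?case by (simp add: x scl_def)
  qed auto
  also have "\<dots> = Psi f n (wedge a b) V"
    unfolding Psi_def wedge_def using fin finite_Gen
    by (subst sum.Sigma[symmetric]) (auto simp: sum_distrib_right)
  finally show "Psi f n (wedge a b) V = wedge (Psi f n a) (Psi f n b) V" ..
qed

lemma Psi_Ideal:
  assumes f: "\<And>e. linear_form (f e)" and R: "\<And>r. r \<in> Rel n \<Longrightarrow> Psi f n r = (\<lambda>S. 0)"
    and "a \<in> Ideal n"
  shows "Psi f n a = (\<lambda>S. 0)"
  using assms(3)
  by (induction rule: Ideal.induct) (auto simp: Psi_wedge[where f=f, OF f] R Psi_eadd)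

section \<open>Interval forms of a forest order\<close>

text \<open>Together with transitivity, \<open>up\<close> and \<open>down\<close> make comparability
  transitive, so the order is a disjoint union of chains. The fork relation rests on
  \<open>up\<close>, the relation for converging edges on \<open>down\<close>.\<close>

locale forest_order =
  fixes L :: "(nat \<times> nat) set"
  assumes irrefl: "(i,i) \<notin> L"
    and trans: "(i,j) \<in> L \<Longrightarrow> (j,k) \<in> L \<Longrightarrow> (i,k) \<in> L"
    and up: "(i,j) \<in> L \<Longrightarrow> (i,k) \<in> L \<Longrightarrow> j \<noteq> k \<Longrightarrow> (j,k) \<in> L \<or> (k,j) \<in> L"
    and down: "(i,k) \<in> L \<Longrightarrow> (j,k) \<in> L \<Longrightarrow> i \<noteq> j \<Longrightarrow> (i,j) \<in> L \<or> (j,i) \<in> L"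
begin

text \<open>The odd variable of the vertex \<open>v\<close> is encoded as the generator \<open>(v,v)\<close>, which lies outside
  \<open>Gen n\<close>.\<close>

definition ivl :: "nat \<times> nat \<Rightarrow> ext" where
  "ivl e = (\<lambda>S. if \<exists>v. S = {(v,v)} \<and> (fst e, v) \<in> L \<and> (v = snd e \<or> (v, snd e) \<in> L) then 1 else 0)"

lemma asym: "(i,j) \<in> L \<Longrightarrow> (j,i) \<notin> L"
  using irrefl trans by blast

lemma linear_form_ivl: "linear_form (ivl e)"
  by (auto simp: linear_form_def ivl_def)

text \<open>A vertex of the interval would yield \<open>(i,j) \<in> L\<close> by
  transitivity.\<close>

lemma ivl_zero: "(i,j) \<notin> L \<Longrightarrow> ivl (i,j) = (\<lambda>S. 0)"
  using trans by (fastforce simp: ivl_def)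

text \<open>Half-open intervals are disjoint here, since \<open>j\<close> belongs to the first one
  only, and \<open>up\<close> makes every vertex after \<open>i\<close> comparable with
  \<open>j\<close> unless it equals \<open>j\<close>.\<close>

lemma ivl_add:
  assumes "(i,j) \<in> L" "(j,k) \<in> L"
  shows "ivl (i,k) = eadd (ivl (i,j)) (ivl (j,k))"
proof
  fix S
  show "ivl (i,k) S = eadd (ivl (i,j)) (ivl (j,k)) S"
  proof (cases "\<exists>v. S = {(v,v)}")
    case True
    then obtain v where v: "S = {(v,v)}" by auto
    have "(i,v) \<in> L \<and> (v = k \<or> (v,k) \<in> L) \<longleftrightarrow>
        ((i,v) \<in> L \<and> (v = j \<or> (v,j) \<in> L)) \<or> ((j,v) \<in> L \<and> (v = k \<or> (v,k) \<in> L))"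
      using assms trans up by metis
    moreover have "\<not> ((v = j \<or> (v,j) \<in> L) \<and> (j,v) \<in> L)"
      using irrefl asym by blast
    ultimately show ?thesis by (auto simp: ivl_def eadd_def v)
  qed (auto simp: ivl_def eadd_def)
qed

lemma Psi_gen:
  assumes "(i,j) \<in> Gen n"
  shows "Psi ivl n (gen i j) = ivl (i,j)"
  using assms by (simp add: gen_eq_bas Psi_bas oprod_singleton linear_form_ivl)

lemma Psi_wedge_gen:
  assumes "(i,j) \<in> Gen n" "(k,l) \<in> Gen n"
  shows "Psi ivl n (wedge (gen i j) (gen k l)) = wedge (ivl (i,j)) (ivl (k,l))"
  using assms by (simp add: Psi_wedge[where f=ivl, OF linear_form_ivl] Psi_gen)

text \<open>If \<open>j\<close> precedes \<open>k\<close>, additivity splits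
  \<open>ivl (i,k)\<close>, the repeated form squares to 0, and the term with
  \<open>ivl (k,j)\<close> vanishes. If \<open>k\<close> precedes \<open>j\<close>, the same
  argument followed by anticommutation produces the minus sign.\<close>

lemma ivl_out:
  assumes "j \<noteq> k"
  shows "wedge (ivl (i,j)) (ivl (i,k)) = esub (wedge (ivl (i,j)) (ivl (j,k))) (wedge (ivl (i,k)) (ivl (k,j)))"
proof (cases "(i,j) \<in> L \<and> (i,k) \<in> L")
  case True
  then consider "(j,k) \<in> L" | "(k,j) \<in> L" using up assms by blast
  then show ?thesis
  proof cases
    case 1
    have "wedge (ivl (i,j)) (ivl (i,k)) = wedge (ivl (i,j)) (ivl (j,k))"
      using True 1 by (simp add: ivl_add[of i j k] wedge_eadd_right wedge_self linear_form_ivl)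
    then show ?thesis using asym[OF 1] by (simp add: ivl_zero esub_def)
  next
    case 2
    have "wedge (ivl (i,j)) (ivl (i,k)) = wedge (ivl (k,j)) (ivl (i,k))"
      using True 2 by (simp add: ivl_add[of i k j] wedge_eadd_left wedge_self linear_form_ivl)
    then show ?thesis using asym[OF 2] wedge_anticomm[OF linear_form_ivl linear_form_ivl, of "(k,j)" "(i,k)"]
      by (simp add: ivl_zero esub_def scl_def)
  qed
next
  case False
  \<comment> \<open>Were both factors of a product on the right nonzero, transitivity would put both
    \<open>j\<close> and \<open>k\<close> after \<open>i\<close>, against the case
    assumption.\<close>
  then have "(i,j) \<notin> L \<or> (j,k) \<notin> L" "(i,k) \<notin> L \<or> (k,j) \<notin> L" using trans by blast+
  then show ?thesis using False by (auto simp: ivl_zero esub_def)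
qed

lemma ivl_in:
  assumes "i \<noteq> j"
  shows "wedge (ivl (i,k)) (ivl (j,k)) = esub (wedge (ivl (i,j)) (ivl (j,k))) (wedge (ivl (j,i)) (ivl (i,k)))"
proof (cases "(i,k) \<in> L \<and> (j,k) \<in> L")
  case True
  then consider "(i,j) \<in> L" | "(j,i) \<in> L" using down assms by blast
  then show ?thesis
  proof cases
    case 1
    have "wedge (ivl (i,k)) (ivl (j,k)) = wedge (ivl (i,j)) (ivl (j,k))"
      using True 1 by (simp add: ivl_add[of i j k] wedge_eadd_left wedge_self linear_form_ivl)
    then show ?thesis using asym[OF 1] by (simp add: ivl_zero esub_def)
  next
    case 2
    have "wedge (ivl (i,k)) (ivl (j,k)) = wedge (ivl (i,k)) (ivl (j,i))"
      using True 2 by (simp add: ivl_add[of j i k] wedge_eadd_right wedge_self linear_form_ivl)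
    then show ?thesis using asym[OF 2] wedge_anticomm[OF linear_form_ivl linear_form_ivl, of "(i,k)" "(j,i)"]
      by (simp add: ivl_zero esub_def scl_def)
  qed
next
  case False
  then have "(i,j) \<notin> L \<or> (j,k) \<notin> L" "(j,i) \<notin> L \<or> (i,k) \<notin> L" using trans by blast+
  then show ?thesis using False by (auto simp: ivl_zero esub_def)
qed

lemma Psi_Rel:
  assumes "r \<in> Rel n"
  shows "Psi ivl n r = (\<lambda>S. 0)"
proof -
  have G: "(i,j) \<in> Gen n" if "i \<in> {1..n}" "j \<in> {1..n}" "i \<noteq> j" for i j
    using that by (simp add: Gen_def)
  have sub: "esub a a = (\<lambda>S. 0)" for a by (simp add: esub_def)
  consider (out) i j k where "r = esub (wedge (gen i j) (gen i k))
          (esub (wedge (gen i j) (gen j k)) (wedge (gen i k) (gen k j)))"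
      "i \<in> {1..n}" "j \<in> {1..n}" "k \<in> {1..n}" "i \<noteq> j" "i \<noteq> k" "j \<noteq> k"
    | ("in") i j k where "r = esub (wedge (gen i k) (gen j k))
          (esub (wedge (gen i j) (gen j k)) (wedge (gen j i) (gen i k)))"
      "i \<in> {1..n}" "j \<in> {1..n}" "k \<in> {1..n}" "i \<noteq> j" "i \<noteq> k" "j \<noteq> k"
    | (two) i j where "r = wedge (gen i j) (gen j i)" "i \<in> {1..n}" "j \<in> {1..n}" "i \<noteq> j"
    using assms unfolding Rel_def by blast
  then show ?thesis
  proof cases
    case out
    then show ?thesis using ivl_out[of j k i] by (simp add: Psi_esub Psi_wedge_gen G sub)
  next
    case "in"
    then show ?thesis using ivl_in[of i j k] by (simp add: Psi_esub Psi_wedge_gen G sub)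
  next
    case two
    then have "(i,j) \<notin> L \<or> (j,i) \<notin> L" using asym by blast
    then show ?thesis using two by (auto simp: Psi_wedge_gen G ivl_zero)
  qed
qed

lemma Psi_Ideal_zero: "a \<in> Ideal n \<Longrightarrow> Psi ivl n a = (\<lambda>S. 0)"
  using linear_form_ivl Psi_Rel by (rule Psi_Ideal)

end

section \<open>Chain gangs are independent\<close>

definition precedes :: "nat list set \<Rightarrow> (nat \<times> nat) set" where
  "precedes P = {(b ! p, b ! q) | b p q. b \<in> P \<and> p < q \<and> q < length b}"

lemma precedesI: "b \<in> P \<Longrightarrow> p < q \<Longrightarrow> q < length b \<Longrightarrow> (b ! p, b ! q) \<in> precedes P"
  by (auto simp: precedes_def)

lemma precedesE:
  assumes "(i,j) \<in> precedes P"
  obtains b p q where "b \<in> P" "p < q" "q < length b" "i = b ! p" "j = b ! q"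
  using assms by (auto simp: precedes_def)

lemma gang_edges_precedes: "gang_edges P \<subseteq> precedes P"
  by (auto simp: gang_edges_def pset_conv_nth intro!: precedesI)

lemma precedes_nth_iff:
  assumes P: "P \<in> chain_gangs n" and b: "b \<in> P" "p < length b" "q < length b"
  shows "(b ! p, b ! q) \<in> precedes P \<longleftrightarrow> p < q"
proof
  assume "(b ! p, b ! q) \<in> precedes P"
  then obtain c p' q' where c: "c \<in> P" "p' < q'" "q' < length c" "b ! p = c ! p'" "b ! q = c ! q'"
    by (rule precedesE)
  then have "b = c" using chain_gangD(5)[OF P b(1) c(1), of "b ! p"] b by (metis nth_mem order_less_trans)
  then show "p < q" using c b chain_gangD(3)[OF P b(1)] by (auto simp: nth_eq_iff_index_eq)
qed (use b in \<open>simp add: precedesI\<close>)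

lemma precedes_block:
  assumes P: "P \<in> chain_gangs n" and "(i,j) \<in> precedes P" "b \<in> P" "i \<in> set b \<or> j \<in> set b"
  obtains p q where "p < q" "q < length b" "i = b ! p" "j = b ! q"
proof -
  from assms(2) obtain c p q where c: "c \<in> P" "p < q" "q < length c" "i = c ! p" "j = c ! q"
    by (rule precedesE)
  then have "b = c" using assms(3,4) chain_gangD(5)[OF P] by (metis nth_mem order_less_trans)
  then show ?thesis using that c by blast
qed

text \<open>Comparable vertices share a block, and there the order is that of positions; each axiom
  thus reduces to a comparison of indices.\<close>

lemma forest_order_precedes:
  assumes P: "P \<in> chain_gangs n"
  shows "forest_order (precedes P)"
proof
  show "(i,i) \<notin> precedes P" for i
  proof
    assume *: "(i,i) \<in> precedes P"
    then obtain b p q where "b \<in> P" "p < q" "q < length b" "i = b ! p" "i = b ! q"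
      by (rule precedesE)
    then show False using chain_gangD(3)[OF P] by (auto simp: nth_eq_iff_index_eq)
  qed
  show "(i,k) \<in> precedes P" if ij: "(i,j) \<in> precedes P" and jk: "(j,k) \<in> precedes P" for i j k
  proof -
    from ij obtain b p q where b: "b \<in> P" "p < q" "q < length b" "i = b ! p" "j = b ! q"
      by (rule precedesE)
    obtain q' r where r: "q' < r" "r < length b" "j = b ! q'" "k = b ! r"
      using precedes_block[OF P jk b(1)] b by auto
    have "q' = q" using b r chain_gangD(3)[OF P b(1)] by (simp add: nth_eq_iff_index_eq)
    then show ?thesis using b r by (auto intro: precedesI)
  qed
  show "(j,k) \<in> precedes P \<or> (k,j) \<in> precedes P"
    if ij: "(i,j) \<in> precedes P" and ik: "(i,k) \<in> precedes P" and "j \<noteq> k" for i j k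
  proof -
    from ij obtain b p q where b: "b \<in> P" "p < q" "q < length b" "i = b ! p" "j = b ! q"
      by (rule precedesE)
    obtain p' r where r: "p' < r" "r < length b" "i = b ! p'" "k = b ! r"
      using precedes_block[OF P ik b(1)] b by auto
    have "q \<noteq> r" using \<open>j \<noteq> k\<close> b r by auto
    then show ?thesis using b r precedesI[of b P q r] precedesI[of b P r q] by (auto simp: neq_iff)
  qed
  show "(i,j) \<in> precedes P \<or> (j,i) \<in> precedes P"
    if ik: "(i,k) \<in> precedes P" and jk: "(j,k) \<in> precedes P" and "i \<noteq> j" for i j k
  proof -
    from ik obtain b p q where b: "b \<in> P" "p < q" "q < length b" "i = b ! p" "k = b ! q"
      by (rule precedesE)
    obtain r q' where r: "r < q'" "q' < length b" "j = b ! r" "k = b ! q'"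
      using precedes_block[OF P jk b(1)] b by auto
    have "p \<noteq> r" using \<open>i \<noteq> j\<close> b r by auto
    then show ?thesis using b r precedesI[of b P p r] precedesI[of b P r p] by (auto simp: neq_iff)
  qed
qed

text \<open>Any two vertices in order within a block of \<open>Q\<close> are joined by a path of
  edges of \<open>Q\<close>, and \<open>precedes P\<close> is transitive.\<close>

lemma precedes_mono:
  assumes P: "P \<in> chain_gangs n" and sub: "gang_edges Q \<subseteq> precedes P"
  shows "precedes Q \<subseteq> precedes P"
proof
  interpret forest_order "precedes P" using P by (rule forest_order_precedes)
  fix e assume "e \<in> precedes Q"
  then obtain b p q where b: "b \<in> Q" "p < q" "q < length b" "e = (b ! p, b ! q)"
    by (auto simp: precedes_def)
  \<comment> \<open>The bound on \<open>q\<close> stays inside the formula because the induction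
    also visits intermediate endpoints.\<close>
  have "q < length b \<longrightarrow> (b ! p, b ! q) \<in> precedes P"
    using b(2)
  proof (induction rule: less_Suc_induct)
    case (1 i)
    then show ?case using sub b(1) by (auto simp: gang_edges_def pset_conv_nth)
  next
    case (2 i j k)
    then show ?case using trans by (meson order_less_trans)
  qed
  then show "e \<in> precedes P" using b by simp
qed

text \<open>Unequal heads would be related by \<open>R\<close> in both directions. Asymmetry also
  excludes repeated entries, so the tails have equal sets.\<close>

lemma sorted_wrt_set_unique:
  assumes "\<And>x y. R x y \<Longrightarrow> \<not> R y x" "sorted_wrt R xs" "sorted_wrt R ys" "set xs = set ys"
  shows "xs = ys"
  using assms(2-)
proof (induction xs arbitrary: ys)
  case (Cons x xs)
  then obtain y zs where ys: "ys = y # zs" by (cases ys) auto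
  have "x = y"
  proof (rule ccontr)
    assume "x \<noteq> y"
    then have "R x y" "R y x" using Cons.prems ys by auto
    then show False using assms(1) by blast
  qed
  have irrefl: "\<not> R x x" using assms(1) by blast
  then have "x \<notin> set xs" "x \<notin> set zs"
    using Cons.prems(1,2) unfolding ys \<open>x = y\<close> by auto
  moreover have "insert x (set xs) = insert x (set zs)"
    using Cons.prems(3) ys \<open>x = y\<close> by simp
  ultimately have "set xs = set zs" by (simp add: insert_ident)
  then have "xs = zs" using Cons.IH[of zs] Cons.prems(1,2) ys by simp
  then show ?case using ys \<open>x = y\<close> by simp
qed simp

text \<open>The block of \<open>v\<close> consists of \<open>v\<close> and the vertices comparable
  with it, and the order then fixes its arrangement. Singleton blocks are recovered because the
  blocks cover all vertices.\<close>

lemma precedes_inject_subset: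
  assumes P: "P \<in> chain_gangs n" and Q: "Q \<in> chain_gangs n" and eq: "precedes P = precedes Q"
  shows "P \<subseteq> Q"
proof
  interpret forest_order "precedes P" using P by (rule forest_order_precedes)
  fix b assume b: "b \<in> P"
  then obtain v where v: "v \<in> set b" using chain_gangD(2)[OF P] by fastforce
  then obtain c where c: "c \<in> Q" "v \<in> set c" using chain_gangD(4)[OF P b] chain_gangD(6)[OF Q] by blast
  \<comment> \<open>Stated for arbitrary gangs so that exchanging \<open>P\<close> and
    \<open>Q\<close> gives the reverse inclusion.\<close>
  have sub: "set d \<subseteq> set e"
    if P: "P \<in> chain_gangs n" and Q: "Q \<in> chain_gangs n" and eq: "precedes P = precedes Q"
      and d: "d \<in> P" "v \<in> set d" and e: "e \<in> Q" "v \<in> set e" for d e P Q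
  proof
    fix w assume "w \<in> set d"
    then obtain p q where pq: "p < length d" "q < length d" "v = d ! p" "w = d ! q"
      using d by (auto simp: in_set_conv_nth)
    show "w \<in> set e"
    proof (cases "w = v")
      case False
      then have "p \<noteq> q" using pq by auto
      then have "p < q \<or> q < p" by arith
      then have "(v,w) \<in> precedes Q \<or> (w,v) \<in> precedes Q"
        using pq d(1) eq precedesI by metis
      then show ?thesis
        using precedes_block[OF Q _ e(1)] e(2) by (metis nth_mem order_less_trans)
    qed (use e in simp)
  qed
  have "set b = set c" using sub[OF P Q eq b v c] sub[OF Q P eq[symmetric] c b v] by blast
  moreover have "sorted_wrt (\<lambda>x y. (x,y) \<in> precedes P) b"
    using b by (auto simp: sorted_wrt_iff_nth_less intro: precedesI)
  moreover have "sorted_wrt (\<lambda>x y. (x,y) \<in> precedes P) c"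
    using c eq by (auto simp: sorted_wrt_iff_nth_less intro: precedesI)
  ultimately have "b = c" by (intro sorted_wrt_set_unique[where R="\<lambda>x y. (x,y) \<in> precedes P"] asym)
  then show "b \<in> Q" using c by simp
qed

lemma precedes_inject:
  assumes "P \<in> chain_gangs n" "Q \<in> chain_gangs n" "precedes P = precedes Q"
  shows "P = Q"
  using precedes_inject_subset assms by (metis subset_antisym)

section \<open>Chain-gang monomials under the interval homomorphism\<close>

lemma ivl_gang_edge:
  assumes P: "P \<in> chain_gangs n" and "(i,j) \<in> gang_edges P"
  shows "forest_order.ivl (precedes P) (i,j) = bas {(j,j)}"
proof -
  interpret forest_order "precedes P" using P by (rule forest_order_precedes)
  have ij: "(i,j) \<in> precedes P" using assms gang_edges_precedes by auto
  obtain b p where b: "b \<in> P" "Suc p < length b" "i = b ! p" "j = b ! Suc p"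
    using assms(2) by (auto simp: gang_edges_def pset_conv_nth)
  \<comment> \<open>The ends of an edge are consecutive in their block, so the half-open interval
    contains only the target.\<close>
  have no: "\<not> ((i,v) \<in> precedes P \<and> (v,j) \<in> precedes P)" for v
  proof
    assume v: "(i,v) \<in> precedes P \<and> (v,j) \<in> precedes P"
    then obtain q where q: "q < length b" "v = b ! q"
      using precedes_block[OF P _ b(1), of i v] b by auto
    then have "p < q" "q < Suc p" using v b precedes_nth_iff[OF P b(1)] by auto
    then show False by simp
  qed
  show ?thesis
  proof
    fix S
    show "ivl (i,j) S = bas {(j,j)} S" using no ij by (auto simp: ivl_def bas_def)
  qed
qed

text \<open>Ensures that the variables attached to different edges are different, so that their
  product is nonzero.\<close>

lemma gang_edges_target_inj:
  assumes P: "P \<in> chain_gangs n" and "(i,j) \<in> gang_edges P" "(k,j) \<in> gang_edges P"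
  shows "i = k"
proof -
  obtain b p where b: "b \<in> P" "Suc p < length b" "i = b ! p" "j = b ! Suc p"
    using assms(2) by (auto simp: gang_edges_def pset_conv_nth)
  obtain c q where c: "c \<in> P" "Suc q < length c" "k = c ! q" "j = c ! Suc q"
    using assms(3) by (auto simp: gang_edges_def pset_conv_nth)
  have "j \<in> set b" "j \<in> set c" using nth_mem[OF b(2)] nth_mem[OF c(2)] b(4) c(4) by simp_all
  then have "b = c" by (rule chain_gangD(5)[OF P b(1) c(1)])
  moreover have "Suc p = Suc q"
    using b(2,4) c(2,4) chain_gangD(3)[OF P b(1)] nth_eq_iff_index_eq[of b "Suc p" "Suc q"] \<open>b = c\<close>
    by simp
  ultimately show ?thesis using b(3) c(3) by simp
qed

text \<open>Each edge goes to the variable of its target, and the targets are distinct, so the image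
  is a nonzero multiple of a single basis monomial.\<close>

lemma Psi_cg_mono_self:
  assumes P: "P \<in> chain_gangs n"
  shows "\<exists>V. Psi (forest_order.ivl (precedes P)) n (cg_mono P) V \<noteq> 0"
proof -
  interpret forest_order "precedes P" using P by (rule forest_order_precedes)
  have fin: "finite (gang_edges P)" using gang_edges_Gen[OF P] finite_Gen finite_subset by blast
  have "\<exists>s. s \<noteq> 0 \<and> foldr (\<lambda>e. wedge (ivl e)) (sorted_list_of_set (gang_edges P)) one
      = scl s (bas (\<Union>e\<in>set (sorted_list_of_set (gang_edges P)). {(snd e, snd e)}))"
  proof (intro foldr_wedge_bas conjI)
    fix e assume e: "e \<in> set (sorted_list_of_set (gang_edges P))"
    then show "\<exists>s. s \<noteq> 0 \<and> ivl e = scl s (bas {(snd e, snd e)})"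
      using ivl_gang_edge[OF P, of "fst e" "snd e"] fin by (auto intro!: exI[of _ 1])
    fix e' assume "e' \<in> set (sorted_list_of_set (gang_edges P))" "e \<noteq> e'"
    then have "snd e \<noteq> snd e'"
      using e gang_edges_target_inj[OF P, of "fst e" "snd e" "fst e'"] fin by (auto simp: prod_eq_iff)
    then show "{(snd e, snd e)} \<inter> {(snd e', snd e')} = {}" by simp
  qed auto
  then obtain s W where s: "s \<noteq> 0" "oprod ivl (gang_edges P) = scl s (bas W)"
    unfolding oprod_def by blast
  obtain t where t: "t \<noteq> 0" "cg_mono P = scl t (bas (gang_edges P))"
    using cg_mono_eq_bas[OF P] by auto
  have "Psi ivl n (cg_mono P) = scl (t * s) (bas W)"
    using gang_edges_Gen[OF P] by (simp add: t Psi_scl Psi_bas s)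
  then have "Psi ivl n (cg_mono P) W = t * s" by (simp add: scl_def bas_def)
  then show ?thesis using s t by (intro exI[of _ W]) simp
qed

text \<open>By \<open>precedes_mono\<close>, some edge of \<open>Q\<close> is not in the order of
  \<open>P\<close>; its interval form is 0 and kills the product.\<close>

lemma Psi_cg_mono_other:
  assumes P: "P \<in> chain_gangs n" and Q: "Q \<in> chain_gangs n" and nsub: "\<not> precedes Q \<subseteq> precedes P"
  shows "Psi (forest_order.ivl (precedes P)) n (cg_mono Q) = (\<lambda>S. 0)"
proof -
  interpret forest_order "precedes P" using P by (rule forest_order_precedes)
  obtain i j where ij: "(i,j) \<in> gang_edges Q" "(i,j) \<notin> precedes P"
    using precedes_mono[OF P] nsub by fastforce
  have fin: "finite (gang_edges Q)" using gang_edges_Gen[OF Q] finite_Gen finite_subset by blast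
  obtain t where t: "cg_mono Q = scl t (bas (gang_edges Q))"
    using cg_mono_eq_bas[OF Q] by auto
  have "Psi ivl n (cg_mono Q) = scl t (\<lambda>S. 0)"
    using gang_edges_Gen[OF Q] oprod_zero[where f=ivl, OF fin ij(1) ivl_zero[OF ij(2)]]
    by (simp add: t Psi_scl Psi_bas)
  then show ?thesis by (simp add: scl_def)
qed

lemma finite_precedes:
  assumes P: "P \<in> chain_gangs n"
  shows "finite (precedes P)"
proof (rule finite_subset)
  show "precedes P \<subseteq> {1..n} \<times> {1..n}"
  proof
    fix e assume "e \<in> precedes P"
    then obtain b p q where b: "b \<in> P" "p < q" "q < length b" "e = (b ! p, b ! q)"
      by (auto simp: precedes_def)
    then have "b ! p \<in> set b" "b ! q \<in> set b" by simp_all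
    then show "e \<in> {1..n} \<times> {1..n}" using chain_gangD(4)[OF P b(1)] b(4) by blast
  qed
qed simp

text \<open>A triangular system: the homomorphism of \<open>P\<close> leaves only gangs
  \<open>Q\<close> whose order is contained in that of \<open>P\<close>. For \<open>Q\<close> other
  than \<open>P\<close> the inclusion is strict by \<open>precedes_inject\<close>, so the induction
  hypothesis removes its coefficient.\<close>

lemma chain_gangs_independent:
  assumes I: "(\<lambda>S. \<Sum>P\<in>chain_gangs n. c P * cg_mono P S) \<in> Ideal n" and P: "P \<in> chain_gangs n"
  shows "c P = 0"
  using P
proof (induction "card (precedes P)" arbitrary: P rule: less_induct)
  case less
  interpret forest_order "precedes P" using less.prems by (rule forest_order_precedes)
  obtain V where V: "Psi ivl n (cg_mono P) V \<noteq> 0"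
    using Psi_cg_mono_self[OF less.prems] by auto
  have other: "c Q * Psi ivl n (cg_mono Q) V = 0" if Q: "Q \<in> chain_gangs n - {P}" for Q
  proof (cases "precedes Q \<subseteq> precedes P")
    case True
    then have "precedes Q \<subset> precedes P" using Q precedes_inject less.prems by blast
    then have "card (precedes Q) < card (precedes P)"
      using finite_precedes[OF less.prems] by (intro psubset_card_mono)
    then show ?thesis using less.hyps Q by simp
  next
    case False
    then show ?thesis using Psi_cg_mono_other[OF less.prems] Q by simp
  qed
  have others: "(\<Sum>Q\<in>chain_gangs n - {P}. c Q * Psi ivl n (cg_mono Q) V) = 0"
    using other by (rule sum.neutral[OF ballI])
  have "0 = (\<Sum>Q\<in>chain_gangs n. c Q * Psi ivl n (cg_mono Q) V)"
    using fun_cong[OF Psi_Ideal_zero[OF I], of V] by (simp add: Psi_sum)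
  also have "\<dots> = c P * Psi ivl n (cg_mono P) V"
    using others less.prems finite_chain_gangs by (simp add: sum.remove)
  finally show ?case using V by simp
qed

theorem theorem5p5:
  fixes n :: nat
  shows "(\<forall>a\<in>Ext n. \<exists>c :: nat list set \<Rightarrow> rat.
            esub a (\<lambda>S. \<Sum>P\<in>chain_gangs n. c P * cg_mono P S) \<in> Ideal n)
       \<and> (\<forall>c :: nat list set \<Rightarrow> rat.
            (\<lambda>S. \<Sum>P\<in>chain_gangs n. c P * cg_mono P S) \<in> Ideal n
              \<longrightarrow> (\<forall>P\<in>chain_gangs n. c P = 0))"
  using Ext_cgspan chain_gangs_independent unfolding cgspan_def by blast

end
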